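(* Let $\mathbb G$ be a step 2 Carnot group with CC distance $d$, and let $g:\mathbb G\to\mathbb R$ be bounded and lower semicontinuous. Let $\Phi:[0,+\infty)\to[0,+\infty)$ be continuous, convex, non-decreasing, with $\Phi(0)=0$, coercive in the sense $\Phi(\tau)/\tau\to+\infty$ as $\tau\to+\infty$, and such that its even extension $\widetilde\Phi(s)=\Phi(|s|)$ is locally strongly convex in $\mathbb R$. Let $\Phi^*(s)=\sup_{\tau\ge0}\{s\tau-\Phi(\tau)\}$ for $s\ge0$ and $$u(t,p)=\inf_{q\in\mathbb G}\Big\{g(q)+t\,\Phi^*\Big(\frac{d(p,q)}{t}\Big)\Big\},\qquad t>0,\ p\in\mathbb G$$ (the Hopf–Lax viscosity solution of $u_t+\Phi(|\nabla_Hu|)=0$, $u(0,\cdot)=g$). Then for every $t>0$, $u(t,\cdot)$ is h-semiconcave in $\mathbb G$.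
   Context: A step 2 Carnot group is identified with $\mathbb R^n=\mathbb R^m\times\mathbb R^{n_2}$ with law $p\cdot q=(p^{(1)}+q^{(1)},p^{(2)}+q^{(2)}+\mathcal B(p^{(1)},q^{(1)}))$, $\mathcal B$ skew-symmetric bilinear, identity $0$, $p^{-1}=-p$; $X_1,\dots,X_m$ are the left-invariant fields equal to $\partial/\partial p_i$ at $0$, $\nabla_Hu=(X_1u,\dots,X_mu)$; CC distance $d(p,q)$ = infimum of $\int_0^1|u|$ over absolutely continuous curves from $p$ to $q$ with $\dot\gamma=\sum u_iX_i(\gamma)$ a.e. $\mathcal H_0=\mathbb R^m\times\{0\}$, $|\cdot|$ Euclidean norm. A lower semicontinuous $v$ on $\mathbb G$ is h-semiconcave if there is $C\ge0$ with $v(p\cdot h)+v(p\cdot h^{-1})-2v(p)\le C|h|^2$ for all $p\in\mathbb G$, $h\in\mathcal H_0$. A function $f$ on $\mathbb R$ is locally strongly convex if for every compact interval $K$ there is $C(K)>0$ with $\lambda f(x)+(1-\lambda)f(y)-f(\lambda x+(1-\lambda)y)\ge\lambda(1-\lambda)C(K)|x-y|^2$ for all $x,y\in K$, $\lambda\in[0,1]$. *)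

theory Defs
  imports "HOL-Analysis.Analysis"
begin

text \<open>Step 2 Carnot group on real^'m x real^'k with law
  p.q = (p1+q1, p2+q2+B(p1,q1)), B skew-symmetric bilinear and bracket generating.\<close>

definition carnot2 :: "(real^'m \<Rightarrow> real^'m \<Rightarrow> real^'k) \<Rightarrow> bool" where
  "carnot2 B \<longleftrightarrow> bilinear B \<and> (\<forall>x y. B x y = - B y x)
     \<and> span (range (\<lambda>(x, y). B x y)) = UNIV"

definition gmult :: "(real^'m \<Rightarrow> real^'m \<Rightarrow> real^'k) \<Rightarrow> ((real^'m) \<times> (real^'k))
    \<Rightarrow> ((real^'m) \<times> (real^'k)) \<Rightarrow> ((real^'m) \<times> (real^'k))" where
  "gmult B p q = (fst p + fst q, snd p + snd q + B (fst p) (fst q))"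

definition abs_cont_on :: "real \<Rightarrow> real \<Rightarrow> (real \<Rightarrow> 'a::real_normed_vector) \<Rightarrow> bool" where
  "abs_cont_on a b f \<longleftrightarrow> (\<forall>e>0. \<exists>d>0. \<forall>(n::nat) (s::nat \<Rightarrow> real) (t::nat \<Rightarrow> real).
      (\<forall>i<n. a \<le> s i \<and> s i \<le> t i \<and> t i \<le> b)
      \<and> (\<forall>i<n. \<forall>j<n. i \<noteq> j \<longrightarrow> t i \<le> s j \<or> t j \<le> s i)
      \<and> (\<Sum>i<n. t i - s i) < d
      \<longrightarrow> (\<Sum>i<n. norm (f (t i) - f (s i))) < e)"

text \<open>Horizontal (sub-unit style) curves: absolutely continuous gamma on [0,1] from p to q
  with gamma' = sum_i u_i X_i(gamma) a.e., where X_i(x) = (e_i, B(x1, e_i)),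
  so that sum_i u_i X_i(x) = (u, B(x1,u)).\<close>
definition horiz_control ::
  "(real^'m \<Rightarrow> real^'m \<Rightarrow> real^'k) \<Rightarrow> ((real^'m) \<times> (real^'k)) \<Rightarrow> ((real^'m) \<times> (real^'k))
     \<Rightarrow> (real \<Rightarrow> (real^'m) \<times> (real^'k)) \<Rightarrow> (real \<Rightarrow> real^'m) \<Rightarrow> bool" where
  "horiz_control B p q \<gamma> u \<longleftrightarrow> abs_cont_on 0 1 \<gamma> \<and> \<gamma> 0 = p \<and> \<gamma> 1 = q
     \<and> set_integrable lborel {0..1} u
     \<and> (AE t in lborel. t \<in> {0..1} \<longrightarrow>
          (\<gamma> has_vector_derivative (u t, B (fst (\<gamma> t)) (u t))) (at t))"

definition cc_dist :: "(real^'m \<Rightarrow> real^'m \<Rightarrow> real^'k) \<Rightarrow> ((real^'m) \<times> (real^'k))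
    \<Rightarrow> ((real^'m) \<times> (real^'k)) \<Rightarrow> real" where
  "cc_dist B p q = Inf {(LINT t:{0..1}|lborel. norm (u t)) | \<gamma> u. horiz_control B p q \<gamma> u}"

definition lsc :: "('a::topological_space \<Rightarrow> real) \<Rightarrow> bool" where
  "lsc f \<longleftrightarrow> (\<forall>a. open {x. a < f x})"

definition h_semiconcave :: "(real^'m \<Rightarrow> real^'m \<Rightarrow> real^'k) \<Rightarrow> ((real^'m) \<times> (real^'k) \<Rightarrow> real) \<Rightarrow> bool" where
  "h_semiconcave B v \<longleftrightarrow> lsc v \<and> (\<exists>C\<ge>0. \<forall>p. \<forall>h::real^'m.
      v (gmult B p (h, 0)) + v (gmult B p (- (h, 0))) - 2 * v p \<le> C * (norm h)\<^sup>2)"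

definition loc_strongly_convex :: "(real \<Rightarrow> real) \<Rightarrow> bool" where
  "loc_strongly_convex f \<longleftrightarrow> (\<forall>a b. \<exists>C>0. \<forall>x\<in>{a..b}. \<forall>y\<in>{a..b}. \<forall>l\<in>{0..1}.
      l * f x + (1 - l) * f y - f (l * x + (1 - l) * y) \<ge> l * (1 - l) * C * \<bar>x - y\<bar>\<^sup>2)"

definition conj_star :: "(real \<Rightarrow> real) \<Rightarrow> real \<Rightarrow> real" where
  "conj_star \<Phi> s = (SUP \<tau>\<in>{0..}. s * \<tau> - \<Phi> \<tau>)"

definition hopf_lax :: "(real^'m \<Rightarrow> real^'m \<Rightarrow> real^'k) \<Rightarrow> (real \<Rightarrow> real)
    \<Rightarrow> ((real^'m) \<times> (real^'k) \<Rightarrow> real) \<Rightarrow> real \<Rightarrow> (real^'m) \<times> (real^'k) \<Rightarrow> real" where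
  "hopf_lax B \<Phi> g t p = (INF q. g q + t * conj_star \<Phi> (cc_dist B p q / t))"

end

theory Submission
  imports Defs "HOL-Computational_Algebra.Fundamental_Theorem_Algebra"
begin

text \<open>
Write \<open>\<psi>\<close> for the conjugate of \<open>\<Phi>\<close>. By left invariance everything reduces to bounding
\<open>\<psi> (d(0, h w) / t) + \<psi> (d(0, h\<^sup>-\<^sup>1 w) / t) - 2 \<psi> (d(0, w) / t)\<close> by a multiple of \<open>|h|\<^sup>2\<close>, uniformly
for \<open>d(0, w)\<close> bounded; the boundedness of \<open>g\<close> confines nearly optimal points to a fixed ball.

Nearly shortest curves are replaced by words, i.e. products of \<open>N\<close> horizontal elements. Minimising
the discrete energy plus a penalty on the endpoint, instead of fixing the endpoint, always gives a
normal Lagrange multiplier: the letters of a minimiser satisfy \<open>(1 + A) a(k+1) = (1 - A) a(k)\<close> with \<open>A\<close>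
skew, so they are \<open>R\<^sup>k x\<close> for an orthogonal map \<open>R\<close>, and all have the same norm.

Adding \<open>(f(j) - f(j+1)) h\<close> to the letters changes the product \<open>w\<close> into \<open>h w\<close> exactly, for both signs of
\<open>h\<close>, as soon as \<open>f\<close> descends from 1 to 0 and is orthogonal to the letters. Since the letters satisfy a
linear recurrence of order at most \<open>m\<close> with unimodular characteristic roots, such an \<open>f\<close> exists with
increments \<open>O(1/N)\<close> and a constant depending on \<open>m\<close> only: start from a tent function and convolve once
for each root.

Finally, strong convexity of \<open>\<Phi>(|.|)\<close> dualises to
\<open>\<psi>(|v+w|) + \<psi>(|v-w|) \<le> 2 \<psi>(|v|) + K |w|\<^sup>2\<close>, which is applied letter by letter and combined by Jensen's
inequality.
\<close>

subsection \<open>Absolutely continuous functions\<close>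

text \<open>Perturbed words have to hit their endpoint exactly: a vertical error of order
  \<open>|h|^2\<close> costs a distance of order \<open>|h|\<close>, which would ruin a second-order
  estimate. The exact perturbation is linear in \<open>h\<close>, so one family of weights serves
  \<open>h\<close> and \<open>-h\<close> and the first-order terms cancel in the sum.

  The weights must be bounded independently of the minimiser. No bound on the multiplier is
  available, so \<open>R\<close> may be any orthogonal map; only the degree of an annihilating
  polynomial and the modulus of its roots are controlled, and the estimate of the weights uses
  nothing else.

  Equality of the letter norms is essential at the end. Jensen's inequality bounds
  \<open>\<psi>\<close> of a length by an average of \<open>\<psi>\<close> over letters, which is
  the wrong direction for the unperturbed word; when all its letters have the same norm, that
  average is exactly \<open>\<psi>\<close> of its length divided by \<open>t\<close>.\<close>

text \<open>The definition numbers the intervals, whereas the intervals of a tagged division are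
  most naturally indexed by the tagged pairs themselves.\<close>

lemma abs_cont_onE:
  assumes "abs_cont_on a b f" "e > 0"
  obtains d where "d > 0"
    "\<And>I s t. \<lbrakk>finite (I::'i set); \<And>i. i \<in> I \<Longrightarrow> a \<le> s i \<and> s i \<le> t i \<and> t i \<le> b;
        \<And>i j. \<lbrakk>i \<in> I; j \<in> I; i \<noteq> j\<rbrakk> \<Longrightarrow> t i \<le> s j \<or> t j \<le> s i;
        (\<Sum>i\<in>I. t i - s i) < d\<rbrakk> \<Longrightarrow> (\<Sum>i\<in>I. norm (f (t i) - f (s i))) < e"
proof -
  obtain d where d: "d > 0" and H: "\<And>n s t.
      \<lbrakk>\<forall>i<n::nat. a \<le> s i \<and> s i \<le> t i \<and> t i \<le> b; \<forall>i<n. \<forall>j<n. i \<noteq> j \<longrightarrow> t i \<le> s j \<or> t j \<le> s i;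
      (\<Sum>i<n. t i - s i) < d\<rbrakk> \<Longrightarrow> (\<Sum>i<n. norm (f (t i) - f (s i))) < e"
    using assms unfolding abs_cont_on_def by auto
  have "(\<Sum>i\<in>I. norm (f (t i) - f (s i))) < e"
    if I: "finite I" and B: "\<And>i. i \<in> I \<Longrightarrow> a \<le> s i \<and> s i \<le> t i \<and> t i \<le> b"
      and D: "\<And>i j. \<lbrakk>i \<in> I; j \<in> I; i \<noteq> j\<rbrakk> \<Longrightarrow> t i \<le> s j \<or> t j \<le> s i"
      and L: "(\<Sum>i\<in>I. t i - s i) < d" for I :: "'i set" and s t
  proof -
    obtain h where h: "bij_betw h {..<card I} I"
      using ex_bij_betw_nat_finite[OF I] by (auto simp: atLeast0LessThan)
    have hI: "h i \<in> I" if "i < card I" for i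
      using h that by (auto simp: bij_betw_def)
    have hne: "h i \<noteq> h j" if "i < card I" "j < card I" "i \<noteq> j" for i j
      using h that by (auto simp: bij_betw_def inj_on_def)
    have "(\<Sum>i<card I. norm (f (t (h i)) - f (s (h i)))) < e"
      using B D L hI hne sum.reindex_bij_betw[OF h, of "\<lambda>i. t i - s i"]
      by (intro H) auto
    then show ?thesis
      using sum.reindex_bij_betw[OF h, of "\<lambda>i. norm (f (t i) - f (s i))"] by simp
  qed
  with d show ?thesis by (rule that)
qed

lemma sum_length_le_measure:
  fixes s t :: "'i \<Rightarrow> real"
  assumes I: "finite I" and st: "\<And>i. i \<in> I \<Longrightarrow> s i \<le> t i"
    and D: "\<And>i j. \<lbrakk>i \<in> I; j \<in> I; i \<noteq> j\<rbrakk> \<Longrightarrow> t i \<le> s j \<or> t j \<le> s i"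
    and T: "\<And>i. i \<in> I \<Longrightarrow> {s i<..<t i} \<subseteq> T" "T \<in> lmeasurable"
  shows "(\<Sum>i\<in>I. t i - s i) \<le> measure lebesgue T"
proof -
  have disj: "disjoint_family_on (\<lambda>i. {s i<..<t i}) I"
    unfolding disjoint_family_on_def using D by fastforce
  have "(\<Sum>i\<in>I. t i - s i) = (\<Sum>i\<in>I. measure lebesgue {s i<..<t i})"
    using st by (intro sum.cong) auto
  also have "\<dots> = measure lebesgue (\<Union>i\<in>I. {s i<..<t i})"
    using I st disj by (intro measure_finite_Union[symmetric]) auto
  also have "\<dots> \<le> measure lebesgue T"
    using T I by (intro measure_mono_fmeasurable) auto
  finally show ?thesis .
qed

text \<open>A gauge argument. Intervals tagged outside \<open>E\<close> are controlled by
  differentiability at the tag; those tagged in \<open>E\<close> are forced into an open set of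
  small measure, where absolute continuity makes the total increment of \<open>f\<close> small.
  Integrability of \<open>f'\<close> is thus a conclusion.\<close>

theorem fundamental_theorem_of_calculus_abs_cont:
  fixes f :: "real \<Rightarrow> 'a::banach"
  assumes ac: "abs_cont_on a b f" and ab: "a \<le> b" and E: "negligible E"
    and vd: "\<And>x. x \<in> {a..b} - E \<Longrightarrow> (f has_vector_derivative f' x) (at x within {a..b})"
  shows "(f' has_integral (f b - f a)) {a..b}"
proof -
  \<comment> \<open>With value 0 on \<open>E\<close>, tags in \<open>E\<close> contribute nothing to
    the Riemann sum, and only the increments of \<open>f\<close> remain there.\<close>
  define g where "g x = (if x \<in> E then 0 else f' x)" for x
  have "(g has_integral (f b - f a)) {a..b}"
    unfolding has_integral_real
  proof (intro allI impI)
    fix e :: real assume e: "e > 0"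
    define e' where "e' = e / (2 * (b - a + 1))"
    have e': "e' > 0" "e' * (b - a) < e / 2"
      using e ab by (auto simp: e'_def field_simps)
    obtain \<delta> where \<delta>: "\<delta> > 0" and H: "\<And>I s t. \<lbrakk>finite (I::(real \<times> real set) set);
        \<And>i. i \<in> I \<Longrightarrow> a \<le> s i \<and> s i \<le> t i \<and> t i \<le> b;
        \<And>i j. \<lbrakk>i \<in> I; j \<in> I; i \<noteq> j\<rbrakk> \<Longrightarrow> t i \<le> s j \<or> t j \<le> s i;
        (\<Sum>i\<in>I. t i - s i) < \<delta>\<rbrakk> \<Longrightarrow> (\<Sum>i\<in>I. norm (f (t i) - f (s i))) < e / 2"
      by (rule abs_cont_onE[OF ac, of "e/2", where ?'i = "real \<times> real set"]) (use e in auto)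
    have En: "E \<in> null_sets lebesgue"
      using E negligible_iff_null_sets by blast
    obtain T where T: "open T" "E \<subseteq> T" "T - E \<in> lmeasurable" "emeasure lebesgue (T - E) < ennreal \<delta>"
      using sets_lebesgue_outer_open[of E \<delta>] En \<delta> by blast
    have TE: "T = (T - E) \<union> E" using T(2) by blast
    have eT: "emeasure lebesgue T < ennreal \<delta>"
      using emeasure_Un_null_set[of "T - E" lebesgue E] T(3,4) En TE by (metis fmeasurableD)
    then have Tm: "T \<in> lmeasurable"
      using T(1) by (intro fmeasurableI) (auto intro: less_trans)
    have mT: "measure lebesgue T < \<delta>"
      using eT Tm \<delta> by (metis emeasure_eq_measure2 ennreal_less_iff measure_nonneg)
    have "\<forall>x. \<exists>r>0. x \<in> {a..b} - E \<longrightarrow>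
         (\<forall>y\<in>{a..b}. norm (y-x) < r \<longrightarrow> norm (f y - f x - (y-x) *\<^sub>R f' x) \<le> e' * norm (y-x))"
      using vd[unfolded has_vector_derivative_def has_derivative_within_alt] e'(1) zero_less_one by blast
    then obtain r where r: "\<And>x. 0 < r x"
        "\<And>x y. \<lbrakk>x \<in> {a..b} - E; y \<in> {a..b}; norm (y-x) < r x\<rbrakk>
                        \<Longrightarrow> norm (f y - f x - (y-x) *\<^sub>R f' x) \<le> e' * norm (y-x)"
      by metis
    define \<gamma> where "\<gamma> x = (if x \<in> E then T else ball x (r x))" for x
    show "\<exists>\<gamma>. gauge \<gamma> \<and> (\<forall>\<D>. \<D> tagged_division_of {a..b} \<and> \<gamma> fine \<D> \<longrightarrow>
        norm ((\<Sum>(x,k)\<in>\<D>. Henstock_Kurzweil_Integration.content k *\<^sub>R g x) - (f b - f a)) < e)"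
    proof (intro exI conjI allI impI)
      show "gauge \<gamma>"
        using T r(1) by (auto simp: gauge_def \<gamma>_def)
    next
      fix p assume p: "p tagged_division_of {a..b} \<and> \<gamma> fine p"
      then have ptag: "p tagged_division_of {a..b}" and fine: "\<gamma> fine p" by auto
      have finp: "finite p" using ptag by auto
      have K: "\<exists>u v. K = {u..v} \<and> u \<le> v \<and> x \<in> K \<and> a \<le> u \<and> v \<le> b \<and> K \<subseteq> \<gamma> x" if xK: "(x, K) \<in> p" for x K
      proof -
        have 1: "x \<in> K" "K \<subseteq> {a..b}" "K \<subseteq> \<gamma> x"
          using tagged_division_ofD(2,3)[OF ptag xK] fine xK unfolding fine_def by auto
        obtain u v where uv: "K = cbox u v" using tagged_division_ofD(4)[OF ptag xK] by auto
        then have "u \<le> v" using 1(1) by auto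
        then show ?thesis using 1 uv by (intro exI[of _ u] exI[of _ v]) auto
      qed
      have ba: "b - a = (\<Sum>(x,K)\<in>p. Sup K - Inf K)" "f b - f a = (\<Sum>(x,K)\<in>p. f(Sup K) - f(Inf K))"
        using additive_tagged_division_1[where f= "\<lambda>x. x"] additive_tagged_division_1[where f= f]
            ab ptag by auto
      \<comment> \<open>Degenerate intervals are left out: a one-point interval may lie inside
        another member of the division, while proper intervals with disjoint interiors are ordered
        on the line.\<close>
      define q where "q = {z \<in> p. fst z \<in> E \<and> Inf (snd z) < Sup (snd z)}"
      have good: "norm (Henstock_Kurzweil_Integration.content K *\<^sub>R g x - (f (Sup K) - f (Inf K))) \<le> e' * (Sup K - Inf K)
          + (if (x, K) \<in> q then norm (f (Sup K) - f (Inf K)) else 0)" if xK: "(x, K) \<in> p" for x K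
      proof -
        obtain u v where uv: "K = {u..v}" "u \<le> v" "x \<in> K" "a \<le> u" "v \<le> b" "K \<subseteq> \<gamma> x"
          using K[OF xK] by blast
        show ?thesis
        proof (cases "x \<in> E")
          case True
          then show ?thesis
            using uv xK e' by (cases "u = v") (auto simp: g_def q_def norm_minus_commute)
        next
          case False
          then have ball: "K \<subseteq> ball x (r x)" using uv by (auto simp: \<gamma>_def)
          then have "u \<in> ball x (r x)" "v \<in> ball x (r x)" using uv by (metis atLeastAtMost_iff order_refl subsetD)+
          then have lt: "norm (u - x) < r x" "norm (v - x) < r x"
            by (auto simp: dist_norm norm_minus_commute)
          have x: "x \<in> {a..b} - E" using uv False by auto
          have "norm ((v - u) *\<^sub>R f' x - (f v - f u)) = norm (f u - f x - (u - x) *\<^sub>R f' x - (f v - f x - (v - x) *\<^sub>R f' x))"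
            by (auto simp: algebra_simps)
          also have "\<dots> \<le> norm (f u - f x - (u - x) *\<^sub>R f' x) + norm (f v - f x - (v - x) *\<^sub>R f' x)"
            by (rule norm_triangle_ineq4)
          also have "\<dots> \<le> e' * norm (u - x) + e' * norm (v - x)"
            using uv by (intro add_mono r(2) x lt) auto
          also have "\<dots> = e' * (v - u)"
            using uv by (simp add: algebra_simps)
          finally show ?thesis using uv False by (auto simp: g_def q_def)
        qed
      qed
      have "(\<Sum>z\<in>q. norm (f (Sup (snd z)) - f (Inf (snd z)))) < e / 2"
      proof (rule H)
        show "finite q" using finp by (auto simp: q_def)
        show "a \<le> Inf (snd i) \<and> Inf (snd i) \<le> Sup (snd i) \<and> Sup (snd i) \<le> b" if "i \<in> q" for i
          using that K[of "fst i" "snd i"] by (auto simp: q_def)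
        show sep: "Sup (snd i) \<le> Inf (snd j) \<or> Sup (snd j) \<le> Inf (snd i)"
          if ij: "i \<in> q" "j \<in> q" "i \<noteq> j" for i j
        proof -
          obtain u v where uv: "snd i = {u..v}" "u \<le> v" using K[of "fst i" "snd i"] ij by (auto simp: q_def)
          obtain u' v' where uv': "snd j = {u'..v'}" "u' \<le> v'" using K[of "fst j" "snd j"] ij by (auto simp: q_def)
          have "interior (snd i) \<inter> interior (snd j) = {}"
            using tagged_division_ofD(5)[OF ptag, of "fst i" "snd i" "fst j" "snd j"] ij by (auto simp: q_def)
          then have "{u<..<v} \<inter> {u'<..<v'} = {}" by (simp add: uv uv')
          moreover have "u < v" "u' < v'" using ij uv uv' by (auto simp: q_def)
          ultimately have "\<not> (max u u' < min v v')" using dense[of "max u u'" "min v v'"] by auto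
          then show ?thesis using uv uv' \<open>u < v\<close> \<open>u' < v'\<close> by auto
        qed
        have "(\<Sum>i\<in>q. Sup (snd i) - Inf (snd i)) \<le> measure lebesgue T"
        proof (rule sum_length_le_measure)
          show "finite q" using finp by (auto simp: q_def)
          show "{Inf (snd i)<..<Sup (snd i)} \<subseteq> T" if "i \<in> q" for i
            using that K[of "fst i" "snd i"] by (force simp: q_def \<gamma>_def)
        qed (use sep Tm in \<open>auto simp: q_def\<close>)
        then show "(\<Sum>i\<in>q. Sup (snd i) - Inf (snd i)) < \<delta>" using mT by simp
      qed
      moreover have "norm ((\<Sum>(x,k)\<in>p. Henstock_Kurzweil_Integration.content k *\<^sub>R g x) - (f b - f a))
         \<le> (\<Sum>z\<in>p. e' * (Sup (snd z) - Inf (snd z)) + (if z \<in> q then norm (f (Sup (snd z)) - f (Inf (snd z))) else 0))"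
      proof -
        have "(\<Sum>(x,k)\<in>p. Henstock_Kurzweil_Integration.content k *\<^sub>R g x) - (f b - f a)
            = (\<Sum>(x,K)\<in>p. Henstock_Kurzweil_Integration.content K *\<^sub>R g x - (f (Sup K) - f (Inf K)))"
          unfolding ba(2) by (simp add: sum_subtractf case_prod_unfold)
        also have "norm \<dots> \<le> (\<Sum>z\<in>p. e' * (Sup (snd z) - Inf (snd z)) + (if z \<in> q then norm (f (Sup (snd z)) - f (Inf (snd z))) else 0))"
          using good by (intro sum_norm_le) force
        finally show ?thesis .
      qed
      moreover have "\<dots> = e' * (b - a) + (\<Sum>z\<in>q. norm (f (Sup (snd z)) - f (Inf (snd z))))"
      proof -
        have "q \<subseteq> p" by (auto simp: q_def)
        then have "(\<Sum>z\<in>p. if z \<in> q then norm (f (Sup (snd z)) - f (Inf (snd z))) else 0)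
            = (\<Sum>z\<in>q. norm (f (Sup (snd z)) - f (Inf (snd z))))"
          using finp by (simp add: sum.If_cases Int_absorb1)
        then show ?thesis
          unfolding ba(1) by (simp add: sum.distrib sum_distrib_left case_prod_unfold)
      qed
      ultimately show "norm ((\<Sum>(x,k)\<in>p. Henstock_Kurzweil_Integration.content k *\<^sub>R g x) - (f b - f a)) < e"
        using e' by linarith
    qed
  qed
  then show ?thesis
    by (rule has_integral_spike[OF E, rotated]) (auto simp: g_def)
qed

section \<open>Closure properties of absolute continuity\<close>

lemma abs_cont_onI:
  assumes "\<And>e. e > 0 \<Longrightarrow> \<exists>d>0. \<forall>(n::nat) s t.
      (\<forall>i<n. a \<le> s i \<and> s i \<le> t i \<and> t i \<le> b) \<longrightarrow>
      (\<forall>i<n. \<forall>j<n. i \<noteq> j \<longrightarrow> t i \<le> s j \<or> t j \<le> s i) \<longrightarrow>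
      (\<Sum>i<n. t i - s i) < d \<longrightarrow> (\<Sum>i<n. norm (f (t i) - f (s i))) < e"
  shows "abs_cont_on a b f"
  unfolding abs_cont_on_def using assms by (intro allI impI) (simp only: imp_conjL)

lemma abs_cont_on_id: "abs_cont_on a b (\<lambda>x::real. x)"
proof (rule abs_cont_onI)
  fix e :: real assume e: "e > 0"
  show "\<exists>d>0. \<forall>(n::nat) s t. (\<forall>i<n. a \<le> s i \<and> s i \<le> t i \<and> t i \<le> b) \<longrightarrow>
      (\<forall>i<n. \<forall>j<n. i \<noteq> j \<longrightarrow> t i \<le> s j \<or> t j \<le> s i) \<longrightarrow>
      (\<Sum>i<n. t i - s i) < d \<longrightarrow> (\<Sum>i<n. norm (t i - s i)) < e"
  proof (intro exI[of _ e] conjI allI impI, rule e)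
    fix n :: nat and s t :: "nat \<Rightarrow> real"
    assume "\<forall>i<n. a \<le> s i \<and> s i \<le> t i \<and> t i \<le> b" "(\<Sum>i<n. t i - s i) < e"
    moreover from this have "(\<Sum>i<n. norm (t i - s i)) = (\<Sum>i<n. t i - s i)"
      by (intro sum.cong) auto
    ultimately show "(\<Sum>i<n. norm (t i - s i)) < e" by simp
  qed
qed

lemma abs_cont_on_dominated:
  assumes f: "abs_cont_on a b f"
    and le: "\<And>x y. norm (g x - g y) \<le> K * norm (f x - f y)"
  shows "abs_cont_on a b g"
proof (rule abs_cont_onI)
  fix e :: real assume e: "e > 0"
  \<comment> \<open>\<open>K\<close> is arbitrary, and the tolerance \<open>e\<close> is divided by
    the factor, so it is made positive.\<close>
  define K' where "K' = max K 1"
  have K': "K' > 0" "\<And>x y. norm (g x - g y) \<le> K' * norm (f x - f y)"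
    unfolding K'_def using order_trans[OF le mult_right_mono[of K "max K 1"]] by auto
  from e K' have "e / K' > 0" by simp
  from abs_cont_onE[OF f this, where ?'i = nat] obtain d where d: "d > 0" and H:
    "\<And>I s t. \<lbrakk>finite (I::nat set); \<And>i. i \<in> I \<Longrightarrow> a \<le> s i \<and> s i \<le> t i \<and> t i \<le> b;
        \<And>i j. \<lbrakk>i \<in> I; j \<in> I; i \<noteq> j\<rbrakk> \<Longrightarrow> t i \<le> s j \<or> t j \<le> s i;
        (\<Sum>i\<in>I. t i - s i) < d\<rbrakk> \<Longrightarrow> (\<Sum>i\<in>I. norm (f (t i) - f (s i))) < e / K'"
    by blast
  show "\<exists>d>0. \<forall>(n::nat) s t. (\<forall>i<n. a \<le> s i \<and> s i \<le> t i \<and> t i \<le> b) \<longrightarrow>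
      (\<forall>i<n. \<forall>j<n. i \<noteq> j \<longrightarrow> t i \<le> s j \<or> t j \<le> s i) \<longrightarrow>
      (\<Sum>i<n. t i - s i) < d \<longrightarrow> (\<Sum>i<n. norm (g (t i) - g (s i))) < e"
  proof (intro exI[of _ d] conjI allI impI, rule d)
    fix n :: nat and s t :: "nat \<Rightarrow> real"
    assume A: "\<forall>i<n. a \<le> s i \<and> s i \<le> t i \<and> t i \<le> b"
      "\<forall>i<n. \<forall>j<n. i \<noteq> j \<longrightarrow> t i \<le> s j \<or> t j \<le> s i" "(\<Sum>i<n. t i - s i) < d"
    have "(\<Sum>i<n. norm (f (t i) - f (s i))) < e / K'"
      using A by (intro H[of "{..<n}" s t]) auto
    moreover have "(\<Sum>i<n. norm (g (t i) - g (s i))) \<le> K' * (\<Sum>i<n. norm (f (t i) - f (s i)))"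
      unfolding sum_distrib_left using K' by (intro sum_mono) auto
    ultimately show "(\<Sum>i<n. norm (g (t i) - g (s i))) < e"
      using K'(1) by (simp add: field_simps)
  qed
qed

lemma abs_cont_on_add:
  assumes f: "abs_cont_on a b f" and g: "abs_cont_on a b g"
  shows "abs_cont_on a b (\<lambda>x. f x + g x)"
proof (rule abs_cont_onI)
  fix e :: real assume e: "e > 0"
  then have e2: "e / 2 > 0" by simp
  from abs_cont_onE[OF f e2, where ?'i = nat] obtain d where d: "d > 0" and H:
    "\<And>I s t. \<lbrakk>finite (I::nat set); \<And>i. i \<in> I \<Longrightarrow> a \<le> s i \<and> s i \<le> t i \<and> t i \<le> b;
        \<And>i j. \<lbrakk>i \<in> I; j \<in> I; i \<noteq> j\<rbrakk> \<Longrightarrow> t i \<le> s j \<or> t j \<le> s i;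
        (\<Sum>i\<in>I. t i - s i) < d\<rbrakk> \<Longrightarrow> (\<Sum>i\<in>I. norm (f (t i) - f (s i))) < e / 2"
    by blast
  from abs_cont_onE[OF g e2, where ?'i = nat] obtain d' where d': "d' > 0" and H':
    "\<And>I s t. \<lbrakk>finite (I::nat set); \<And>i. i \<in> I \<Longrightarrow> a \<le> s i \<and> s i \<le> t i \<and> t i \<le> b;
        \<And>i j. \<lbrakk>i \<in> I; j \<in> I; i \<noteq> j\<rbrakk> \<Longrightarrow> t i \<le> s j \<or> t j \<le> s i;
        (\<Sum>i\<in>I. t i - s i) < d'\<rbrakk> \<Longrightarrow> (\<Sum>i\<in>I. norm (g (t i) - g (s i))) < e / 2"
    by blast
  show "\<exists>d>0. \<forall>(n::nat) s t. (\<forall>i<n. a \<le> s i \<and> s i \<le> t i \<and> t i \<le> b) \<longrightarrow>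
      (\<forall>i<n. \<forall>j<n. i \<noteq> j \<longrightarrow> t i \<le> s j \<or> t j \<le> s i) \<longrightarrow>
      (\<Sum>i<n. t i - s i) < d \<longrightarrow> (\<Sum>i<n. norm (f (t i) + g (t i) - (f (s i) + g (s i)))) < e"
  proof (intro exI[of _ "min d d'"] conjI allI impI)
    show "min d d' > 0" using d d' by simp
    fix n :: nat and s t :: "nat \<Rightarrow> real"
    assume A: "\<forall>i<n. a \<le> s i \<and> s i \<le> t i \<and> t i \<le> b"
      "\<forall>i<n. \<forall>j<n. i \<noteq> j \<longrightarrow> t i \<le> s j \<or> t j \<le> s i" "(\<Sum>i<n. t i - s i) < min d d'"
    have "(\<Sum>i<n. norm (f (t i) + g (t i) - (f (s i) + g (s i))))
        \<le> (\<Sum>i<n. norm (f (t i) - f (s i)) + norm (g (t i) - g (s i)))"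
      by (intro sum_mono) (metis add_diff_add norm_triangle_ineq)
    moreover have "(\<Sum>i<n. norm (f (t i) - f (s i))) < e / 2"
      using A by (intro H[of "{..<n}" s t]) auto
    moreover have "(\<Sum>i<n. norm (g (t i) - g (s i))) < e / 2"
      using A by (intro H'[of "{..<n}" s t]) auto
    ultimately show "(\<Sum>i<n. norm (f (t i) + g (t i) - (f (s i) + g (s i)))) < e"
      by (simp add: sum.distrib)
  qed
qed

text \<open>\<open>m\<close> is allowed to be constant on pieces, which covers the clamped time
  changes \<open>min (2 * t) 1\<close> and \<open>max (2 * t - 1) 0\<close> used for
  concatenation.\<close>

lemma abs_cont_on_reparam:
  assumes f: "abs_cont_on a b f"
    and m: "\<And>x. c \<le> x \<Longrightarrow> x \<le> d \<Longrightarrow> a \<le> m x \<and> m x \<le> b"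
    and mono: "\<And>x y. x \<le> y \<Longrightarrow> m x \<le> m y \<and> m y - m x \<le> K * (y - x)" and K: "K > 0"
  shows "abs_cont_on c d (\<lambda>x. f (m x))"
proof (rule abs_cont_onI)
  fix e :: real assume e: "e > 0"
  from abs_cont_onE[OF f e, where ?'i = nat] obtain \<delta> where \<delta>: "\<delta> > 0" and H:
    "\<And>I s t. \<lbrakk>finite (I::nat set); \<And>i. i \<in> I \<Longrightarrow> a \<le> s i \<and> s i \<le> t i \<and> t i \<le> b;
        \<And>i j. \<lbrakk>i \<in> I; j \<in> I; i \<noteq> j\<rbrakk> \<Longrightarrow> t i \<le> s j \<or> t j \<le> s i;
        (\<Sum>i\<in>I. t i - s i) < \<delta>\<rbrakk> \<Longrightarrow> (\<Sum>i\<in>I. norm (f (t i) - f (s i))) < e"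
    by blast
  show "\<exists>\<delta>>0. \<forall>(n::nat) s t. (\<forall>i<n. c \<le> s i \<and> s i \<le> t i \<and> t i \<le> d) \<longrightarrow>
      (\<forall>i<n. \<forall>j<n. i \<noteq> j \<longrightarrow> t i \<le> s j \<or> t j \<le> s i) \<longrightarrow>
      (\<Sum>i<n. t i - s i) < \<delta> \<longrightarrow> (\<Sum>i<n. norm (f (m (t i)) - f (m (s i)))) < e"
  proof (intro exI[of _ "\<delta> / K"] conjI allI impI)
    show "\<delta> / K > 0" using \<delta> K by simp
    fix n :: nat and s t :: "nat \<Rightarrow> real"
    assume A: "\<forall>i<n. c \<le> s i \<and> s i \<le> t i \<and> t i \<le> d"
      "\<forall>i<n. \<forall>j<n. i \<noteq> j \<longrightarrow> t i \<le> s j \<or> t j \<le> s i" "(\<Sum>i<n. t i - s i) < \<delta> / K"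
    have "(\<Sum>i<n. m (t i) - m (s i)) \<le> K * (\<Sum>i<n. t i - s i)"
      unfolding sum_distrib_left using A mono by (intro sum_mono) auto
    also have "\<dots> < \<delta>" using A K by (simp add: field_simps)
    finally have L: "(\<Sum>i<n. m (t i) - m (s i)) < \<delta>" .
    have "a \<le> m (s i) \<and> m (s i) \<le> m (t i) \<and> m (t i) \<le> b" if "i < n" for i
    proof -
      have "c \<le> s i" "s i \<le> t i" "t i \<le> d" using A that by auto
      then show ?thesis using m[of "s i"] m[of "t i"] mono[of "s i" "t i"] by auto
    qed
    moreover have "m (t i) \<le> m (s j) \<or> m (t j) \<le> m (s i)" if "i < n" "j < n" "i \<noteq> j" for i j
      using A(2) that mono by blast
    ultimately show "(\<Sum>i<n. norm (f (m (t i)) - f (m (s i)))) < e"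
      using L by (intro H[of "{..<n}" "\<lambda>i. m (s i)" "\<lambda>i. m (t i)"]) auto
  qed
qed

lemma abs_cont_on_subset:
  assumes "abs_cont_on a b f" "a \<le> c" "d \<le> b"
  shows "abs_cont_on c d f"
proof (rule abs_cont_onI)
  fix e :: real assume e: "e > 0"
  from abs_cont_onE[OF assms(1) e, where ?'i = nat] obtain \<delta> where \<delta>: "\<delta> > 0" and H:
    "\<And>I s t. \<lbrakk>finite (I::nat set); \<And>i. i \<in> I \<Longrightarrow> a \<le> s i \<and> s i \<le> t i \<and> t i \<le> b;
        \<And>i j. \<lbrakk>i \<in> I; j \<in> I; i \<noteq> j\<rbrakk> \<Longrightarrow> t i \<le> s j \<or> t j \<le> s i;
        (\<Sum>i\<in>I. t i - s i) < \<delta>\<rbrakk> \<Longrightarrow> (\<Sum>i\<in>I. norm (f (t i) - f (s i))) < e"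
    by blast
  show "\<exists>\<delta>>0. \<forall>(n::nat) s t. (\<forall>i<n. c \<le> s i \<and> s i \<le> t i \<and> t i \<le> d) \<longrightarrow>
      (\<forall>i<n. \<forall>j<n. i \<noteq> j \<longrightarrow> t i \<le> s j \<or> t j \<le> s i) \<longrightarrow>
      (\<Sum>i<n. t i - s i) < \<delta> \<longrightarrow> (\<Sum>i<n. norm (f (t i) - f (s i))) < e"
  proof (intro exI[of _ \<delta>] conjI allI impI, rule \<delta>)
    fix n :: nat and s t :: "nat \<Rightarrow> real"
    assume A: "\<forall>i<n. c \<le> s i \<and> s i \<le> t i \<and> t i \<le> d"
      "\<forall>i<n. \<forall>j<n. i \<noteq> j \<longrightarrow> t i \<le> s j \<or> t j \<le> s i" "(\<Sum>i<n. t i - s i) < \<delta>"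
    show "(\<Sum>i<n. norm (f (t i) - f (s i))) < e"
      using A assms(2,3) by (intro H[of "{..<n}" s t]) fastforce+
  qed
qed

lemma abs_cont_on_modulus:
  assumes "abs_cont_on a b f" "e > 0"
  obtains d where "d > 0" "\<And>s t. \<lbrakk>a \<le> s; s \<le> t; t \<le> b; t - s < d\<rbrakk> \<Longrightarrow> norm (f t - f s) < e"
proof -
  from abs_cont_onE[OF assms, where ?'i = nat] obtain d where d: "d > 0" and H:
    "\<And>I s t. \<lbrakk>finite (I::nat set); \<And>i. i \<in> I \<Longrightarrow> a \<le> s i \<and> s i \<le> t i \<and> t i \<le> b;
        \<And>i j. \<lbrakk>i \<in> I; j \<in> I; i \<noteq> j\<rbrakk> \<Longrightarrow> t i \<le> s j \<or> t j \<le> s i;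
        (\<Sum>i\<in>I. t i - s i) < d\<rbrakk> \<Longrightarrow> (\<Sum>i\<in>I. norm (f (t i) - f (s i))) < e"
    by blast
  have "norm (f t - f s) < e" if "a \<le> s" "s \<le> t" "t \<le> b" "t - s < d" for s t
    using H[of "{0}" "\<lambda>_. s" "\<lambda>_. t"] that by simp
  with d show ?thesis by (rule that)
qed

subsection \<open>The Carnot-Caratheodory distance\<close>

locale step2_group =
  fixes B :: "real^'m \<Rightarrow> real^'m \<Rightarrow> real^'k"
  assumes carnot: "carnot2 B"
begin

lemma bounded_bilinear_B: "bounded_bilinear B"
  using carnot by (simp add: carnot2_def bilinear_conv_bounded_bilinear)

sublocale B: bounded_bilinear B by (rule bounded_bilinear_B)

lemma skew: "B x y = - B y x"
  using carnot unfolding carnot2_def by blast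

lemma B_self [simp]: "B x x = 0"
proof -
  have "B x x + B x x = 0" using skew[of x x] by (metis add.right_inverse)
  then have "2 *\<^sub>R B x x = 0" by (simp add: scaleR_2)
  then show ?thesis by simp
qed

abbreviation gm (infixl "\<star>" 70) where "p \<star> q \<equiv> gmult B p q"

lemma gm_assoc: "(p \<star> q) \<star> r = p \<star> (q \<star> r)"
  by (simp add: gmult_def B.add_left B.add_right algebra_simps)

lemma gm_0 [simp]: "0 \<star> p = p" "p \<star> 0 = p"
  by (simp_all add: gmult_def B.zero_left B.zero_right)

lemma gm_inverse [simp]: "(- p) \<star> p = 0" "p \<star> (- p) = 0"
  by (simp_all add: gmult_def B.minus_left B.minus_right prod_eq_iff)

lemma gm_inverse_cancel [simp]: "(- p) \<star> (p \<star> q) = q" "p \<star> ((- p) \<star> q) = q"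
  by (simp_all flip: gm_assoc)

text \<open>Upper bounds for lengths compose and translate directly, without asking whether the
  infimum in \<open>cc_dist\<close> is attained.\<close>

definition reach :: "(real^'m) \<times> (real^'k) \<Rightarrow> (real^'m) \<times> (real^'k) \<Rightarrow> real \<Rightarrow> bool" where
  "reach p q L \<longleftrightarrow> (\<exists>\<gamma> u. horiz_control B p q \<gamma> u \<and> (LINT t:{0..1}|lborel. norm (u t)) \<le> L)"

lemma reach_mono: "reach p q L \<Longrightarrow> L \<le> L' \<Longrightarrow> reach p q L'"
  unfolding reach_def by (meson order_trans)

text \<open>Left translation is affine, \<open>a + T x\<close>, and \<open>T\<close> sends the
  horizontal velocity with control \<open>u\<close> at \<open>x\<close> to the one with the same
  control at the translated point. Hence the control and its length do not change.\<close>

lemma reach_translate: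
  assumes "reach p q L"
  shows "reach (a \<star> p) (a \<star> q) L"
proof -
  obtain \<gamma> u where h: "horiz_control B p q \<gamma> u" and L: "(LINT t:{0..1}|lborel. norm (u t)) \<le> L"
    using assms by (auto simp: reach_def)
  define T where "T x = (fst x, snd x + B (fst a) (fst x))" for x
  have T: "bounded_linear T"
    unfolding T_def
    by (intro bounded_linear_Pair bounded_linear_add bounded_linear_fst bounded_linear_snd
        B.bounded_linear_right[THEN bounded_linear_compose])
  have gT: "a \<star> x = a + T x" for x
    by (simp add: gmult_def T_def prod_eq_iff)
  have "horiz_control B (a \<star> p) (a \<star> q) (\<lambda>t. a \<star> \<gamma> t) u"
    unfolding horiz_control_def
  proof (intro conjI)
    have "norm (T (x - y)) \<le> onorm T * norm (x - y)" for x y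
      by (rule onorm[OF T])
    then have le: "norm (a \<star> \<gamma> x - a \<star> \<gamma> y) \<le> onorm T * norm (\<gamma> x - \<gamma> y)" for x y
      by (simp add: gT linear_diff[OF bounded_linear.linear[OF T], symmetric])
    have "abs_cont_on 0 1 \<gamma>" using h by (simp add: horiz_control_def)
    then show "abs_cont_on 0 1 (\<lambda>t. a \<star> \<gamma> t)"
      by (rule abs_cont_on_dominated[OF _ le])
    have "AE t in lborel. t \<in> {0..1} \<longrightarrow> (\<gamma> has_vector_derivative (u t, B (fst (\<gamma> t)) (u t))) (at t)"
      using h by (simp add: horiz_control_def)
    then show "AE t in lborel. t \<in> {0..1} \<longrightarrow>
        ((\<lambda>t. a \<star> \<gamma> t) has_vector_derivative (u t, B (fst (a \<star> \<gamma> t)) (u t))) (at t)"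
    proof eventually_elim
      case (elim t)
      show ?case
      proof
        assume "t \<in> {0..1}"
        then have "(\<gamma> has_vector_derivative (u t, B (fst (\<gamma> t)) (u t))) (at t)" using elim by blast
        then have "((\<lambda>t. a + T (\<gamma> t)) has_vector_derivative 0 + T (u t, B (fst (\<gamma> t)) (u t))) (at t)"
          by (intro has_vector_derivative_add has_vector_derivative_const
              bounded_linear.has_vector_derivative[OF T])
        then show "((\<lambda>t. a \<star> \<gamma> t) has_vector_derivative (u t, B (fst (a \<star> \<gamma> t)) (u t))) (at t)"
          by (simp add: gT) (simp add: T_def B.add_left add.commute)
      qed
    qed
  qed (use h in \<open>auto simp: horiz_control_def\<close>)
  with L show ?thesis by (auto simp: reach_def)
qed

text \<open>Along direction \<open>x\<close> the term \<open>B x x\<close> vanishes, so a horizontal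
  one-parameter curve is a straight Euclidean segment with constant control.\<close>

lemma reach_line: "reach p (p \<star> (x, 0)) (norm x)"
proof -
  define c where "c = (x, B (fst p) x)"
  have "horiz_control B p (p \<star> (x, 0)) (\<lambda>t. p + t *\<^sub>R c) (\<lambda>_. x)"
    unfolding horiz_control_def
  proof (intro conjI)
    show "abs_cont_on 0 1 (\<lambda>t. p + t *\<^sub>R c)"
      by (rule abs_cont_on_dominated[OF abs_cont_on_id, where K = "norm c"])
        (simp flip: scaleR_left_diff_distrib)
    show "p + 1 *\<^sub>R c = p \<star> (x, 0)" by (simp add: c_def gmult_def prod_eq_iff)
    show "set_integrable lborel {0..1} (\<lambda>_::real. x)"
      unfolding set_integrable_def by (intro integrable_scaleR_left integrable_real_indicator) auto
    have "((\<lambda>t. p + t *\<^sub>R c) has_vector_derivative c) (at t)" for t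
      by (auto intro!: derivative_eq_intros)
    then show "AE t in lborel. t \<in> {0..1} \<longrightarrow>
        ((\<lambda>t. p + t *\<^sub>R c) has_vector_derivative (x, B (fst (p + t *\<^sub>R c)) x)) (at t)"
      by (simp add: c_def B.add_left B.scaleR_left)
  qed simp
  moreover have "(LINT t:{0..1::real}|lborel. norm x) = norm x"
    by (simp add: set_lebesgue_integral_def measure_lborel_Icc)
  ultimately show ?thesis
    unfolding reach_def by (intro exI conjI) auto
qed

lemma reach_trans:
  assumes "reach p q L1" "reach q r L2"
  shows "reach p r (L1 + L2)"
proof -
  obtain \<gamma>1 u1 where h1: "horiz_control B p q \<gamma>1 u1" and L1: "(LINT t:{0..1}|lborel. norm (u1 t)) \<le> L1"
    using assms by (auto simp: reach_def)
  obtain \<gamma>2 u2 where h2: "horiz_control B q r \<gamma>2 u2" and L2: "(LINT t:{0..1}|lborel. norm (u2 t)) \<le> L2"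
    using assms by (auto simp: reach_def)
  \<comment> \<open>Cutting the controls off outside the unit interval lets the two affine time
    changes be carried out in integrals over the whole line.\<close>
  define v1 where "v1 t = indicator {0..1} t *\<^sub>R u1 t" for t :: real
  define v2 where "v2 t = indicator {0..1} t *\<^sub>R u2 t" for t :: real
  have iv: "integrable lborel v1" "integrable lborel v2"
    using h1 h2 unfolding horiz_control_def set_integrable_def v1_def[abs_def] v2_def[abs_def] by blast+
  define u where "u t = 2 *\<^sub>R v1 (0 + 2 * t) + 2 *\<^sub>R v2 ((-1) + 2 * t)" for t
  have iu: "integrable lborel u"
    unfolding u_def using iv
    by (intro Bochner_Integration.integrable_add integrable_scaleR_right lborel_integrable_real_affine) auto
  have ind: "indicator {0..1} t *\<^sub>R u t = u t" for t
    by (auto simp: u_def v1_def v2_def indicator_def)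
  \<comment> \<open>On each half one of the two terms is frozen at \<open>q\<close>, so the
    concatenation is a sum and absolute continuity needs no case distinction.\<close>
  define \<gamma> where "\<gamma> t = \<gamma>1 (min (2 * t) 1) + \<gamma>2 (max (2 * t - 1) 0) - q" for t
  have q: "\<gamma>1 1 = q" "\<gamma>2 0 = q" using h1 h2 by (auto simp: horiz_control_def)
  have "horiz_control B p r \<gamma> u"
    unfolding horiz_control_def
  proof (intro conjI)
    have "abs_cont_on 0 1 (\<lambda>t. \<gamma>1 (min (2 * t) 1) + \<gamma>2 (max (2 * t - 1) 0))"
    proof (rule abs_cont_on_add)
      have "abs_cont_on 0 1 \<gamma>1" using h1 by (simp add: horiz_control_def)
      then show "abs_cont_on 0 1 (\<lambda>t. \<gamma>1 (min (2 * t) 1))"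
        by (rule abs_cont_on_reparam[where m = "\<lambda>t. min (2 * t) 1" and K = 2]) auto
      have "abs_cont_on 0 1 \<gamma>2" using h2 by (simp add: horiz_control_def)
      then show "abs_cont_on 0 1 (\<lambda>t. \<gamma>2 (max (2 * t - 1) 0))"
        by (rule abs_cont_on_reparam[where m = "\<lambda>t. max (2 * t - 1) 0" and K = 2]) auto
    qed
    then show "abs_cont_on 0 1 \<gamma>"
      by (rule abs_cont_on_dominated[where K = 1]) (simp add: \<gamma>_def)
    show "\<gamma> 0 = p" "\<gamma> 1 = r" using h1 h2 by (auto simp: \<gamma>_def horiz_control_def)
    show "set_integrable lborel {0..1} u"
      unfolding set_integrable_def ind by (rule iu)
    have "AE t in lborel. t \<in> {0..1} \<longrightarrow> (\<gamma>1 has_vector_derivative (u1 t, B (fst (\<gamma>1 t)) (u1 t))) (at t)"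
      using h1 by (simp add: horiz_control_def)
    then obtain N1 where N1: "{t \<in> space lborel. \<not> (t \<in> {0..1} \<longrightarrow> (\<gamma>1 has_vector_derivative (u1 t, B (fst (\<gamma>1 t)) (u1 t))) (at t))} \<subseteq> N1"
      "N1 \<in> null_sets lborel"
      unfolding eventually_ae_filter by blast
    have "AE t in lborel. t \<in> {0..1} \<longrightarrow> (\<gamma>2 has_vector_derivative (u2 t, B (fst (\<gamma>2 t)) (u2 t))) (at t)"
      using h2 by (simp add: horiz_control_def)
    then obtain N2 where N2: "{t \<in> space lborel. \<not> (t \<in> {0..1} \<longrightarrow> (\<gamma>2 has_vector_derivative (u2 t, B (fst (\<gamma>2 t)) (u2 t))) (at t))} \<subseteq> N2"
      "N2 \<in> null_sets lborel"
      unfolding eventually_ae_filter by blast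
    have D1: "(\<gamma>1 has_vector_derivative (u1 t, B (fst (\<gamma>1 t)) (u1 t))) (at t)"
      if "t \<in> {0..1}" "t \<notin> N1" for t using N1(1) that by (auto simp: subset_iff)
    have D2: "(\<gamma>2 has_vector_derivative (u2 t, B (fst (\<gamma>2 t)) (u2 t))) (at t)"
      if "t \<in> {0..1}" "t \<notin> N2" for t using N2(1) that by (auto simp: subset_iff)
    have "N1 \<in> sets borel" "N2 \<in> sets borel" using N1 N2 by auto
    then have m: "Measurable.pred borel (\<lambda>t. t \<notin> N1)" "Measurable.pred borel (\<lambda>t. t \<notin> N2)"
      by auto
    have "AE t in lborel. 0 + 2 * t \<notin> N1"
      by (rule AE_borel_affine[OF _ m(1) AE_not_in[OF N1(2)]]) simp
    moreover have "AE t in lborel. (-1) + 2 * t \<notin> N2"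
      by (rule AE_borel_affine[OF _ m(2) AE_not_in[OF N2(2)]]) simp
    \<comment> \<open>Derivatives are computed on the two open halves; the three boundary times go
      into the null set.\<close>
    moreover have "AE t in lborel. t \<noteq> 0" "AE t in lborel. t \<noteq> 1 / 2" "AE t in lborel. t \<noteq> (1::real)"
      by (rule AE_lborel_singleton)+
    ultimately show "AE t in lborel. t \<in> {0..1} \<longrightarrow> (\<gamma> has_vector_derivative (u t, B (fst (\<gamma> t)) (u t))) (at t)"
    proof eventually_elim
      case (elim t)
      show ?case
      proof
        assume "t \<in> {0..1}"
        then consider "0 < t" "t < 1/2" | "1/2 < t" "t < 1" using elim by fastforce
        then show "(\<gamma> has_vector_derivative (u t, B (fst (\<gamma> t)) (u t))) (at t)"
        proof cases
          case 1
          then have "(\<gamma>1 has_vector_derivative (u1 (2*t), B (fst (\<gamma>1 (2*t))) (u1 (2*t)))) (at (2*t))"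
            using elim by (intro D1) auto
          moreover have "((\<lambda>t. 2 * t) has_vector_derivative 2) (at t)"
            by (auto intro!: derivative_eq_intros)
          ultimately have "((\<gamma>1 \<circ> (\<lambda>t. 2 * t)) has_vector_derivative
              2 *\<^sub>R (u1 (2*t), B (fst (\<gamma>1 (2*t))) (u1 (2*t)))) (at t)"
            by (intro vector_diff_chain_at)
          then have "(\<gamma> has_vector_derivative 2 *\<^sub>R (u1 (2*t), B (fst (\<gamma>1 (2*t))) (u1 (2*t)))) (at t)"
            by (rule has_vector_derivative_transform_within_open[of _ _ _ "{0<..<1/2}"])
              (use 1 q in \<open>auto simp: \<gamma>_def\<close>)
          moreover have "u t = 2 *\<^sub>R u1 (2*t)" "\<gamma> t = \<gamma>1 (2 * t)"
            using 1 q by (auto simp: u_def v1_def v2_def \<gamma>_def)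
          ultimately show ?thesis by (simp add: B.scaleR_right)
        next
          case 2
          then have "(\<gamma>2 has_vector_derivative (u2 (2*t-1), B (fst (\<gamma>2 (2*t-1))) (u2 (2*t-1)))) (at (2*t-1))"
            using elim by (intro D2) auto
          moreover have "((\<lambda>t. 2 * t - 1) has_vector_derivative 2) (at t)"
            by (auto intro!: derivative_eq_intros)
          ultimately have "((\<gamma>2 \<circ> (\<lambda>t. 2 * t - 1)) has_vector_derivative
              2 *\<^sub>R (u2 (2*t-1), B (fst (\<gamma>2 (2*t-1))) (u2 (2*t-1)))) (at t)"
            by (intro vector_diff_chain_at)
          then have "(\<gamma> has_vector_derivative 2 *\<^sub>R (u2 (2*t-1), B (fst (\<gamma>2 (2*t-1))) (u2 (2*t-1)))) (at t)"
            by (rule has_vector_derivative_transform_within_open[of _ _ _ "{1/2<..<1}"])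
              (use 2 q in \<open>auto simp: \<gamma>_def\<close>)
          moreover have "u t = 2 *\<^sub>R u2 (2*t-1)" "\<gamma> t = \<gamma>2 (2 * t-1)"
            using 2 q by (auto simp: u_def v1_def v2_def \<gamma>_def)
          ultimately show ?thesis by (simp add: B.scaleR_right)
        qed
      qed
    qed
  qed
  moreover have "(LINT t:{0..1}|lborel. norm (u t)) \<le> L1 + L2"
  proof -
    have n: "indicator {0..1} t *\<^sub>R norm (u t) = norm (u t)" for t
      using ind[of t] by (cases "t \<in> {0..1}") auto
    have i1: "integrable lborel (\<lambda>t. norm (v1 (0 + 2 * t)))" "integrable lborel (\<lambda>t. norm (v2 ((-1) + 2 * t)))"
      using iv by (intro integrable_norm lborel_integrable_real_affine; simp)+
    have "(LINT t:{0..1}|lborel. norm (u t)) = (LINT t|lborel. norm (u t))"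
      unfolding set_lebesgue_integral_def n ..
    also have "\<dots> \<le> (LINT t|lborel. 2 *\<^sub>R norm (v1 (0 + 2 * t)) + 2 *\<^sub>R norm (v2 ((-1) + 2 * t)))"
    proof (rule integral_mono)
      show "integrable lborel (\<lambda>t. norm (u t))" using iu by (rule integrable_norm)
      show "integrable lborel (\<lambda>t. 2 *\<^sub>R norm (v1 (0 + 2 * t)) + 2 *\<^sub>R norm (v2 ((-1) + 2 * t)))"
        by (intro Bochner_Integration.integrable_add integrable_scaleR_right i1)
      show "norm (u t) \<le> 2 *\<^sub>R norm (v1 (0 + 2 * t)) + 2 *\<^sub>R norm (v2 ((-1) + 2 * t))" for t
        unfolding u_def by (rule norm_triangle_le) simp
    qed
    also have "\<dots> = 2 *\<^sub>R (LINT t|lborel. norm (v1 (0 + 2 * t))) + 2 *\<^sub>R (LINT t|lborel. norm (v2 ((-1) + 2 * t)))"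
      using i1 by (subst Bochner_Integration.integral_add) (auto simp del: add_0)
    also have "\<dots> = (LINT t|lborel. norm (v1 t)) + (LINT t|lborel. norm (v2 t))"
      using lborel_integral_real_affine[of 2 "\<lambda>t. norm (v1 t)" 0]
        lborel_integral_real_affine[of 2 "\<lambda>t. norm (v2 t)" "-1"] by simp
    also have "\<dots> = (LINT t:{0..1}|lborel. norm (u1 t)) + (LINT t:{0..1}|lborel. norm (u2 t))"
      by (simp add: v1_def v2_def set_lebesgue_integral_def)
    finally show ?thesis using L1 L2 by simp
  qed
  ultimately show ?thesis by (auto simp: reach_def)
qed

lemma reach_gm: "reach 0 p L1 \<Longrightarrow> reach 0 q L2 \<Longrightarrow> reach 0 (p \<star> q) (L1 + L2)"
  using reach_trans[of 0 p L1 "p \<star> q" L2] reach_translate[of 0 q L2 p] by simp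

lemma reach_horizontal: "reach 0 (x, 0) (norm x)"
  using reach_line[of 0 x] by simp

text \<open>The commutator of \<open>(a x, 0)\<close> and \<open>(b y, 0)\<close> is vertical and
  equals \<open>2 a b B x y\<close>. Taking \<open>|a| = |b|\<close> with \<open>2 a b = c\<close>,
  and the sign of \<open>c\<close> in \<open>b\<close>, gives a cost of order
  \<open>sqrt |c|\<close>.\<close>

lemma reach_commutator: "reach 0 (0, c *\<^sub>R B x y) (2 * sqrt (\<bar>c\<bar> / 2) * (norm x + norm y))"
proof -
  define a where "a = sqrt (\<bar>c\<bar> / 2)"
  define b where "b = sgn c * a"
  have ab: "2 * a * b = c" "a \<ge> 0" "\<bar>b\<bar> \<le> a"
    by (auto simp: a_def b_def sgn_if mult.assoc abs_if simp flip: power2_eq_square)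
  have eq: "(0, c *\<^sub>R B x y) = (a *\<^sub>R x, 0) \<star> (b *\<^sub>R y, 0) \<star> (- a *\<^sub>R x, 0) \<star> (- b *\<^sub>R y, 0)"
    using skew[of y x] ab(1)[symmetric]
    by (simp add: gmult_def B.add_left B.scaleR_left B.scaleR_right B.minus_right B.minus_left B.zero_left
       algebra_simps flip: scaleR_add_left)
  have "reach 0 ((a *\<^sub>R x, 0) \<star> (b *\<^sub>R y, 0) \<star> (- a *\<^sub>R x, 0) \<star> (- b *\<^sub>R y, 0))
     (norm (a *\<^sub>R x) + norm (b *\<^sub>R y) + norm (- a *\<^sub>R x) + norm (- b *\<^sub>R y))"
    by (intro reach_gm reach_horizontal)
  then show ?thesis
    unfolding a_def[symmetric] eq
  proof (rule reach_mono)
    show "norm (a *\<^sub>R x) + norm (b *\<^sub>R y) + norm (- a *\<^sub>R x) + norm (- b *\<^sub>R y) \<le> 2 * a * (norm x + norm y)"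
      using ab mult_right_mono[OF ab(3), of "norm y"] by (simp add: algebra_simps)
  qed
qed

lemma reach_sum:
  assumes "finite S" "\<And>s. s \<in> S \<Longrightarrow> reach 0 (0, f s) (L s)"
  shows "reach 0 (0, \<Sum>s\<in>S. f s) (\<Sum>s\<in>S. L s)"
  using assms
proof (induction S)
  case empty
  then show ?case using reach_horizontal[of 0] by (simp add: zero_prod_def)
next
  case (insert s S)
  then have "reach 0 ((0, f s) \<star> (0, \<Sum>s\<in>S. f s)) (L s + (\<Sum>s\<in>S. L s))"
    by (intro reach_gm) auto
  then show ?case using insert by (simp add: gmult_def B.zero_left)
qed

text \<open>The step 2 case of the Chow-Rashevskii theorem. Bracket generation provides a basis of
  the vertical space made of values of \<open>B\<close>; each coordinate is realised by a
  commutator. Continuity of \<open>\<rho>\<close> at 0 is what compares the distance with the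
  Euclidean topology.\<close>

lemma reach_gauge:
  obtains \<rho> where "\<And>p. reach 0 p (\<rho> p)" "(\<rho> \<longlongrightarrow> 0) (at 0)" "\<rho> 0 = 0"
proof -
  obtain S where S: "S \<subseteq> range (\<lambda>(x, y). B x y)" "independent S" "range (\<lambda>(x, y). B x y) \<subseteq> span S"
    using maximal_independent_subset by blast
  have fin: "finite S" using S(2) by (rule independent_imp_finite)
  have span: "span S = UNIV"
    using carnot S(3) unfolding carnot2_def by (metis span_minimal subspace_span top.extremum_uniqueI)
  have "\<forall>s\<in>S. \<exists>x y. s = B x y" using S(1) by fast
  then obtain X Y where XY: "\<And>s. s \<in> S \<Longrightarrow> s = B (X s) (Y s)" by metis
  define c where "c = representation S"
  have rep: "(\<Sum>s\<in>S. c z s *\<^sub>R s) = z" for z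
    unfolding c_def using S(2) span fin by (intro sum_representation_eq) auto
  have lin: "linear (\<lambda>z. c z s)" for s
    unfolding c_def using S(2) span
    by (intro linearI) (simp_all add: representation_add representation_scale)
  define \<rho> where "\<rho> p = norm (fst p) + (\<Sum>s\<in>S. 2 * sqrt (\<bar>c (snd p) s\<bar> / 2) * (norm (X s) + norm (Y s)))"
    for p :: "(real^'m) \<times> (real^'k)"
  have "reach 0 p (\<rho> p)" for p
  proof -
    have "reach 0 (0, \<Sum>s\<in>S. c (snd p) s *\<^sub>R s) (\<Sum>s\<in>S. 2 * sqrt (\<bar>c (snd p) s\<bar> / 2) * (norm (X s) + norm (Y s)))"
    proof (rule reach_sum[OF fin])
      fix s assume "s \<in> S"
      show "reach 0 (0, c (snd p) s *\<^sub>R s) (2 * sqrt (\<bar>c (snd p) s\<bar> / 2) * (norm (X s) + norm (Y s)))"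
        using reach_commutator[of "c (snd p) s" "X s" "Y s"] XY[OF \<open>s \<in> S\<close>] by simp
    qed
    then have "reach 0 ((fst p, 0) \<star> (0, snd p)) (\<rho> p)"
      unfolding rep \<rho>_def by (intro reach_gm reach_horizontal)
    then show ?thesis by (simp add: gmult_def B.zero_right)
  qed
  moreover have "\<rho> 0 = 0"
    using linear_0[OF lin] by (simp add: \<rho>_def)
  moreover have "(\<rho> \<longlongrightarrow> 0) (at 0)"
  proof -
    have cont: "isCont (\<lambda>p::(real^'m) \<times> (real^'k). c (snd p) s) 0" for s
      using lin[of s] unfolding linear_conv_bounded_linear
      by (rule linear_continuous_at[OF bounded_linear_compose[OF _ bounded_linear_snd]])
    have "isCont \<rho> 0"
      unfolding \<rho>_def using cont by (intro continuous_intros) auto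
    then show ?thesis using \<open>\<rho> 0 = 0\<close> by (simp add: isCont_def)
  qed
  ultimately show ?thesis using that by blast
qed

section \<open>Metric properties of the distance\<close>

abbreviation dist_cc where "dist_cc \<equiv> cc_dist B"

lemma cc_dist_le: "reach p q L \<Longrightarrow> dist_cc p q \<le> L"
proof -
  assume "reach p q L"
  then obtain \<gamma> u where h: "horiz_control B p q \<gamma> u" and L: "(LINT t:{0..1}|lborel. norm (u t)) \<le> L"
    by (auto simp: reach_def)
  have "bdd_below {(LINT t:{0..1}|lborel. norm (u t)) | \<gamma> u. horiz_control B p q \<gamma> u}"
    by (rule bdd_belowI[of _ 0]) (auto simp: set_lebesgue_integral_def)
  then have "dist_cc p q \<le> (LINT t:{0..1}|lborel. norm (u t))"
    unfolding cc_dist_def using h by (intro cInf_lower) blast+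
  with L show ?thesis by simp
qed

lemma reach_exists: "\<exists>L. reach p q L"
proof -
  obtain \<rho> where "\<And>p. reach 0 p (\<rho> p)" using reach_gauge by blast
  then have "reach (p \<star> 0) (p \<star> ((- p) \<star> q)) (\<rho> ((- p) \<star> q))" by (intro reach_translate)
  then show ?thesis by auto
qed

text \<open>Without it, \<open>Inf\<close> would be taken over a possibly empty set and its value
  would carry no information.\<close>

lemma controls_nonempty: "{(LINT t:{0..1}|lborel. norm (u t)) | \<gamma> u. horiz_control B p q \<gamma> u} \<noteq> {}"
proof -
  obtain \<gamma> u where "horiz_control B p q \<gamma> u"
    using reach_exists[of p q] unfolding reach_def by blast
  then show ?thesis by blast
qed

lemma cc_dist_nonneg: "dist_cc p q \<ge> 0"
  unfolding cc_dist_def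
proof (rule cInf_greatest[OF controls_nonempty])
  fix x assume "x \<in> {(LINT t:{0..1}|lborel. norm (u t)) | \<gamma> u. horiz_control B p q \<gamma> u}"
  then obtain u :: "real \<Rightarrow> real^'m" where "x = (LINT t:{0..1}|lborel. norm (u t))" by blast
  then show "0 \<le> x" by (simp add: set_lebesgue_integral_def)
qed

lemma reach_near:
  assumes "dist_cc p q < L"
  shows "reach p q L"
proof -
  obtain x where x: "x \<in> {(LINT t:{0..1}|lborel. norm (u t)) | \<gamma> u. horiz_control B p q \<gamma> u}" "x < L"
    using cInf_lessD[OF controls_nonempty] assms unfolding cc_dist_def by blast
  then obtain \<gamma> u where "horiz_control B p q \<gamma> u" "x = (LINT t:{0..1}|lborel. norm (u t))" by blast
  with x(2) show ?thesis unfolding reach_def by (metis less_imp_le)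
qed

lemma cc_dist_triangle: "dist_cc p r \<le> dist_cc p q + dist_cc q r"
proof (rule field_le_epsilon)
  fix e :: real assume "e > 0"
  then have "reach p r ((dist_cc p q + e/2) + (dist_cc q r + e/2))"
    by (intro reach_trans[of p q] reach_near) auto
  then show "dist_cc p r \<le> dist_cc p q + dist_cc q r + e"
    by (auto dest: cc_dist_le)
qed

lemma cc_dist_translate_le: "dist_cc (a \<star> p) (a \<star> q) \<le> dist_cc p q"
proof (rule field_le_epsilon)
  fix e :: real assume "e > 0"
  then have "reach (a \<star> p) (a \<star> q) (dist_cc p q + e)"
    by (intro reach_translate reach_near) auto
  then show "dist_cc (a \<star> p) (a \<star> q) \<le> dist_cc p q + e"
    by (rule cc_dist_le)
qed

lemma cc_dist_translate: "dist_cc (a \<star> p) (a \<star> q) = dist_cc p q"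
  using cc_dist_translate_le[of a p q] cc_dist_translate_le[of "- a" "a \<star> p" "a \<star> q"] by simp

lemma cc_dist_eq: "dist_cc p q = dist_cc 0 ((- p) \<star> q)"
  using cc_dist_translate[of p 0 "(- p) \<star> q"] by simp

lemma cc_dist_self [simp]: "dist_cc p p = 0"
  using cc_dist_le[OF reach_line[of p 0]] cc_dist_nonneg[of p p]
  by (simp add: gmult_def B.zero_right)

text \<open>By left invariance the distance is bounded by the gauge of
  \<open>(- f x) \<star> g x\<close>, which tends to the identity. This is how Euclidean endpoint
  errors are absorbed later.\<close>

lemma cc_dist_tendsto_0:
  assumes "(f \<longlongrightarrow> p) F" "(g \<longlongrightarrow> p) F"
  shows "((\<lambda>x. dist_cc (f x) (g x)) \<longlongrightarrow> 0) F"
proof -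
  obtain \<rho> where \<rho>: "\<And>p. reach 0 p (\<rho> p)" "(\<rho> \<longlongrightarrow> 0) (at 0)" "\<rho> 0 = 0" using reach_gauge by blast
  have "((\<lambda>x. (- f x) \<star> g x) \<longlongrightarrow> (- p) \<star> p) F"
    unfolding gmult_def
    by (intro tendsto_Pair tendsto_add tendsto_fst tendsto_snd tendsto_minus B.tendsto assms)
  then have "((\<lambda>x. (- f x) \<star> g x) \<longlongrightarrow> 0) F" by simp
  then have "((\<lambda>x. \<rho> ((- f x) \<star> g x)) \<longlongrightarrow> \<rho> 0) F"
    using \<rho>(2,3) by (intro isCont_tendsto_compose[of 0 \<rho>]) (auto simp: isCont_def)
  then have "((\<lambda>x. \<rho> ((- f x) \<star> g x)) \<longlongrightarrow> 0) F" using \<rho>(3) by simp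
  then show ?thesis
  proof (rule tendsto_sandwich[OF _ _ tendsto_const, rotated 2])
    show "\<forall>\<^sub>F x in F. dist_cc (f x) (g x) \<le> \<rho> ((- f x) \<star> g x)"
      by (intro always_eventually allI, subst cc_dist_eq) (rule cc_dist_le[OF \<rho>(1)])
  qed (auto simp: cc_dist_nonneg)
qed

end

subsection \<open>Horizontal words\<close>

context step2_group
begin

primrec hprod :: "(nat \<Rightarrow> real^'m) \<Rightarrow> nat \<Rightarrow> (real^'m) \<times> (real^'k)" where
  "hprod a 0 = 0"
| "hprod a (Suc n) = hprod a n \<star> (a n, 0)"

lemma fst_hprod: "fst (hprod a n) = (\<Sum>j<n. a j)"
  by (induction n) (auto simp: gmult_def)

lemma reach_hprod: "reach 0 (hprod a n) (\<Sum>j<n. norm (a j))"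
proof (induction n)
  case 0
  then show ?case using reach_horizontal[of 0] by (simp add: zero_prod_def)
next
  case (Suc n)
  then show ?case by (simp add: reach_gm reach_horizontal)
qed

lemma hprod_cong: "(\<And>j. j < n \<Longrightarrow> a j = b j) \<Longrightarrow> hprod a n = hprod b n"
  by (induction n) auto

lemma hprod_append:
  "hprod (\<lambda>j. if j < n then a j else b (j - n)) (n + m) = hprod a n \<star> hprod b m"
proof (induction m)
  case 0
  have "hprod (\<lambda>j. if j < n then a j else b (j - n)) n = hprod a n"
    by (rule hprod_cong) simp
  then show ?case by simp
next
  case (Suc m)
  then show ?case by (simp add: gm_assoc)
qed

lemma hprod_const: "hprod (\<lambda>_. x) n = (real n *\<^sub>R x, 0)"
proof (induction n)
  case 0
  show ?case by (simp add: zero_prod_def)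
next
  case (Suc n)
  then show ?case by (simp add: gmult_def B.scaleR_left scaleR_left_distrib)
qed

lemma hprod_double: "hprod (\<lambda>j. (1/2) *\<^sub>R a (j div 2)) (2 * n) = hprod a n"
proof (induction n)
  case (Suc n)
  have "(x, 0) \<star> (x, 0) = (2 *\<^sub>R x, 0)" for x
    by (simp add: gmult_def scaleR_2)
  from this[of "(1/2) *\<^sub>R a n"] Suc show ?case by (simp add: gm_assoc)
qed simp

text \<open>The letters are the chords of the horizontal projection on a fine uniform partition, so
  their total length does not exceed that of the curve. The horizontal endpoint is exact; on each
  step the vertical error is the integral of \<open>B (x \<tau> - x (T j)) (u \<tau>)\<close>, at
  most \<open>K * \<eta>\<close> times the length of the step.\<close>

lemma control_polygon:
  assumes h: "horiz_control B 0 w \<gamma> u" and e: "e > 0"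
  obtains n a where "norm (hprod a n - w) < e"
    "(\<Sum>j<n. norm (a j)) \<le> (LINT t:{0..1}|lborel. norm (u t))"
proof -
  have ac: "abs_cont_on 0 1 \<gamma>" and g01: "\<gamma> 0 = 0" "\<gamma> 1 = w" and ui: "set_integrable lborel {0..1} u"
    and AE: "AE t in lborel. t \<in> {0..1} \<longrightarrow> (\<gamma> has_vector_derivative (u t, B (fst (\<gamma> t)) (u t))) (at t)"
    using h by (simp_all add: horiz_control_def)
  define x where "x t = fst (\<gamma> t)" for t
  define z where "z t = snd (\<gamma> t)" for t
  obtain E where E: "{t \<in> space lborel. \<not> (t \<in> {0..1} \<longrightarrow> (\<gamma> has_vector_derivative (u t, B (fst (\<gamma> t)) (u t))) (at t))} \<subseteq> E"
    "E \<in> null_sets lborel"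
    using AE unfolding eventually_ae_filter by blast
  have neg: "negligible E"
    using E(2) by (simp add: negligible_iff_null_sets null_sets_completionI)
  have der: "(\<gamma> has_vector_derivative (u t, B (x t) (u t))) (at t within S)"
    if "t \<in> {0..1} - E" for t S
  proof -
    have "(\<gamma> has_vector_derivative (u t, B (x t) (u t))) (at t)"
      using that E(1) by (auto simp: subset_iff x_def)
    then show ?thesis by (rule has_vector_derivative_at_within)
  qed
  have nu: "set_integrable lborel {0..1} (\<lambda>t. norm (u t))"
    using ui by (rule set_integrable_norm)
  have nui: "(\<lambda>t. norm (u t)) integrable_on {0..1}"
    and Leq: "(LINT t:{0..1}|lborel. norm (u t)) = integral {0..1} (\<lambda>t. norm (u t))"
    using set_borel_integral_eq_integral[OF nu] by auto
  define L where "L = integral {0..1} (\<lambda>t. norm (u t))"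
  have L0: "L \<ge> 0" unfolding L_def by (rule integral_nonneg[OF nui]) simp
  have nuis: "(\<lambda>t. norm (u t)) integrable_on {s..t}" if "0 \<le> s" "t \<le> 1" for s t
    using nui by (rule integrable_on_subinterval) (use that in auto)
  have ftc: "((\<lambda>\<tau>. (u \<tau>, B (x \<tau>) (u \<tau>))) has_integral (\<gamma> t - \<gamma> s)) {s..t}"
    if "0 \<le> s" "s \<le> t" "t \<le> 1" for s t
    using that by (intro fundamental_theorem_of_calculus_abs_cont[OF abs_cont_on_subset[OF ac] _ neg] der) auto
  have ftx: "(u has_integral (x t - x s)) {s..t}" if "0 \<le> s" "s \<le> t" "t \<le> 1" for s t
    using has_integral_linear[OF ftc[OF that] bounded_linear_fst] by (simp add: o_def x_def)
  have ftz: "((\<lambda>\<tau>. B (x \<tau>) (u \<tau>)) has_integral (z t - z s)) {s..t}" if "0 \<le> s" "s \<le> t" "t \<le> 1" for s t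
    using has_integral_linear[OF ftc[OF that] bounded_linear_snd] by (simp add: o_def z_def)
  obtain K where K: "K > 0" "\<And>a b. norm (B a b) \<le> norm a * norm b * K"
    using B.pos_bounded by blast
  \<comment> \<open>The total error is \<open>K * \<eta> * L\<close>; the summand 1 keeps it
    strictly below \<open>e\<close> and avoids dividing by zero when \<open>L = 0\<close>.\<close>
  define \<eta> where "\<eta> = e / (K * (L + 1))"
  have \<eta>: "\<eta> > 0" using e K L0 by (simp add: \<eta>_def)
  obtain \<delta> where \<delta>: "\<delta> > 0" "\<And>s t. \<lbrakk>0 \<le> s; s \<le> t; t \<le> 1; t - s < \<delta>\<rbrakk> \<Longrightarrow> norm (\<gamma> t - \<gamma> s) < \<eta>"
    using abs_cont_on_modulus[OF ac \<eta>] by blast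
  obtain m where m: "inverse (real (Suc m)) < \<delta>"
    using reals_Archimedean[OF \<delta>(1)] by blast
  define n where "n = Suc m"
  define T where "T j = real j / real n" for j
  have T: "T 0 = 0" "T n = 1" "\<And>j. T (Suc j) - T j < \<delta>" "\<And>j. T j \<le> T (Suc j)" "\<And>j. 0 \<le> T j"
    using m by (auto simp: T_def n_def divide_simps)
  have T1: "T j \<le> 1" if "j \<le> n" for j using that by (simp add: T_def n_def)
  define a where "a j = x (T (Suc j)) - x (T j)" for j
  have step: "norm (a j) \<le> integral {T j..T (Suc j)} (\<lambda>t. norm (u t))"
    "norm (z (T (Suc j)) - z (T j) - B (x (T j)) (a j)) \<le> K * \<eta> * integral {T j..T (Suc j)} (\<lambda>t. norm (u t))"
    if j: "j < n" for j
  proof -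
    have b: "0 \<le> T j" "T j \<le> T (Suc j)" "T (Suc j) \<le> 1"
      using T T1[of "Suc j"] j by auto
    have ii: "(\<lambda>t. norm (u t)) integrable_on {T j..T (Suc j)}" using b by (intro nuis)
    have "a j = integral {T j..T (Suc j)} u"
      unfolding a_def using ftx[OF b] by (simp add: integral_unique)
    also have "norm \<dots> \<le> integral {T j..T (Suc j)} (\<lambda>t. norm (u t))"
      using ftx[OF b] ii by (intro integral_norm_bound_integral) (auto simp: has_integral_integrable)
    finally show "norm (a j) \<le> integral {T j..T (Suc j)} (\<lambda>t. norm (u t))" .
    \<comment> \<open>\<open>B (x (T j)) (a j)\<close> is the vertical increment of the word on this
      step, and it is the same integral with the base point frozen.\<close>
    have "((\<lambda>\<tau>. B (x \<tau>) (u \<tau>) - B (x (T j)) (u \<tau>)) has_integral (z (T (Suc j)) - z (T j) - B (x (T j)) (a j))) {T j..T (Suc j)}"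
      using has_integral_diff[OF ftz[OF b] has_integral_linear[OF ftx[OF b] B.bounded_linear_right[of "x (T j)"]]]
      by (simp add: o_def a_def)
    then have hi: "((\<lambda>\<tau>. B (x \<tau> - x (T j)) (u \<tau>)) has_integral (z (T (Suc j)) - z (T j) - B (x (T j)) (a j))) {T j..T (Suc j)}"
      by (simp add: B.diff_left)
    have "norm (integral {T j..T (Suc j)} (\<lambda>\<tau>. B (x \<tau> - x (T j)) (u \<tau>)))
        \<le> integral {T j..T (Suc j)} (\<lambda>t. K * \<eta> * norm (u t))"
    proof (rule integral_norm_bound_integral)
      show "(\<lambda>\<tau>. B (x \<tau> - x (T j)) (u \<tau>)) integrable_on {T j..T (Suc j)}"
        using hi by (rule has_integral_integrable)
      show "(\<lambda>t. K * \<eta> * norm (u t)) integrable_on {T j..T (Suc j)}"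
        using integrable_on_cmult_left[OF ii, of "K * \<eta>"] by simp
      fix \<tau> assume \<tau>: "\<tau> \<in> {T j..T (Suc j)}"
      then have "norm (\<gamma> \<tau> - \<gamma> (T j)) < \<eta>"
        using b T(3)[of j] by (intro \<delta>(2)) auto
      then have "norm (x \<tau> - x (T j)) \<le> \<eta>"
        using norm_fst_le[of "fst (\<gamma> \<tau> - \<gamma> (T j))" "snd (\<gamma> \<tau> - \<gamma> (T j))"]
        unfolding prod.collapse by (simp add: x_def)
      have "norm (B (x \<tau> - x (T j)) (u \<tau>)) \<le> norm (x \<tau> - x (T j)) * norm (u \<tau>) * K" by (rule K)
      also have "\<dots> \<le> \<eta> * norm (u \<tau>) * K"
        using K(1) \<open>norm (x \<tau> - x (T j)) \<le> \<eta>\<close> by (intro mult_right_mono) auto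
      finally show "norm (B (x \<tau> - x (T j)) (u \<tau>)) \<le> K * \<eta> * norm (u \<tau>)" by (simp add: mult_ac)
    qed
    then show "norm (z (T (Suc j)) - z (T j) - B (x (T j)) (a j)) \<le> K * \<eta> * integral {T j..T (Suc j)} (\<lambda>t. norm (u t))"
      using hi by (simp add: integral_unique)
  qed
  have main: "fst (hprod a j) = x (T j) \<and> (\<Sum>i<j. norm (a i)) \<le> integral {0..T j} (\<lambda>t. norm (u t))
      \<and> norm (snd (hprod a j) - z (T j)) \<le> K * \<eta> * integral {0..T j} (\<lambda>t. norm (u t))" if "j \<le> n" for j
    using that
  proof (induction j)
    case 0
    then show ?case using g01 by (simp add: T x_def z_def)
  next
    case (Suc j)
    then have IH: "fst (hprod a j) = x (T j)" "(\<Sum>i<j. norm (a i)) \<le> integral {0..T j} (\<lambda>t. norm (u t))"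
      "norm (snd (hprod a j) - z (T j)) \<le> K * \<eta> * integral {0..T j} (\<lambda>t. norm (u t))" by auto
    have comb: "integral {0..T j} (\<lambda>t. norm (u t)) + integral {T j..T (Suc j)} (\<lambda>t. norm (u t))
        = integral {0..T (Suc j)} (\<lambda>t. norm (u t))"
      using T T1[of "Suc j"] Suc(2) by (intro Henstock_Kurzweil_Integration.integral_combine nuis) auto
    have "snd (hprod a (Suc j)) - z (T (Suc j)) =
       (snd (hprod a j) - z (T j)) - (z (T (Suc j)) - z (T j) - B (x (T j)) (a j))"
      using IH(1) by (simp add: gmult_def)
    also have "norm \<dots> \<le> K * \<eta> * integral {0..T j} (\<lambda>t. norm (u t)) + K * \<eta> * integral {T j..T (Suc j)} (\<lambda>t. norm (u t))"
      by (rule order_trans[OF norm_triangle_ineq4 add_mono[OF IH(3) step(2)]]) (use Suc(2) in simp)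
    also have "\<dots> = K * \<eta> * integral {0..T (Suc j)} (\<lambda>t. norm (u t))"
      unfolding comb[symmetric] by (simp add: algebra_simps)
    finally have "norm (snd (hprod a (Suc j)) - z (T (Suc j))) \<le> K * \<eta> * integral {0..T (Suc j)} (\<lambda>t. norm (u t))" .
    moreover have "fst (hprod a (Suc j)) = x (T (Suc j))"
      using IH(1) by (simp add: gmult_def a_def)
    moreover have "(\<Sum>i<Suc j. norm (a i)) \<le> integral {0..T (Suc j)} (\<lambda>t. norm (u t))"
      using IH(2) step(1)[of j] Suc(2) comb by simp
    ultimately show ?case by blast
  qed
  have "hprod a n - w = (0, snd (hprod a n) - z (T n))"
    using main[of n] T g01 by (simp add: prod_eq_iff x_def z_def)
  then have "norm (hprod a n - w) = norm (snd (hprod a n) - z (T n))"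
    by (simp add: norm_Pair)
  also have "\<dots> \<le> K * \<eta> * L" using main[of n] T by (simp add: L_def)
  also have "K * \<eta> = e / (L + 1)" using K(1) by (simp add: \<eta>_def)
  also have "e / (L + 1) * L < e" using e L0 by (simp add: field_simps)
  finally have "norm (hprod a n - w) < e" .
  moreover have "(\<Sum>j<n. norm (a j)) \<le> (LINT t:{0..1}|lborel. norm (u t))"
    using main[of n] T by (simp add: Leq)
  ultimately show ?thesis by (rule that)
qed

text \<open>Equal horizontal letters simply add up, so a letter can be cut into equal pieces.
  Rounding the number of pieces up costs at most one piece per original letter, hence the summand
  \<open>real n\<close>.\<close>

lemma hprod_refine:
  assumes "s > 0"
  shows "\<exists>N b. hprod b N = hprod a n \<and> (\<forall>j. norm (b j) \<le> s) \<and> real N \<le> real n + (\<Sum>j<n. norm (a j)) / s"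
proof (induction n)
  case 0
  show ?case using assms by (intro exI[of _ 0] exI[of _ "\<lambda>_. 0"]) auto
next
  case (Suc n)
  then obtain N b where b: "hprod b N = hprod a n" "\<And>j. norm (b j) \<le> s" "real N \<le> real n + (\<Sum>j<n. norm (a j)) / s"
    by blast
  define m where "m = nat \<lceil>norm (a n) / s\<rceil>"
  have m: "norm (a n) / s \<le> real m" "real m \<le> norm (a n) / s + 1"
    using assms unfolding m_def by (auto simp: of_nat_nat)
  have m': "m > 0" if "a n \<noteq> 0" using that assms by (simp add: m_def)
  \<comment> \<open>For a zero letter \<open>m = 0\<close>, and division by zero yields
    \<open>y = 0\<close>: the letter disappears.\<close>
  define y where "y = (1 / real m) *\<^sub>R a n"
  have y: "real m *\<^sub>R y = a n" "norm y \<le> s"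
  proof -
    show "real m *\<^sub>R y = a n" using m' by (cases "a n = 0") (auto simp: y_def)
    show "norm y \<le> s"
      using m(1) m' assms by (cases "a n = 0") (auto simp: y_def field_simps)
  qed
  show ?case
  proof (intro exI conjI allI)
    show "hprod (\<lambda>j. if j < N then b j else y) (N + m) = hprod a (Suc n)"
      using hprod_append[of N b "\<lambda>_. y" m] b(1) y(1) by (simp add: hprod_const)
    show "norm (if j < N then b j else y) \<le> s" for j using b(2) y(2) by simp
    show "real (N + m) \<le> real (Suc n) + (\<Sum>j<Suc n. norm (a j)) / s"
      using b(3) m(2) by (simp add: add_divide_distrib)
  qed
qed

text \<open>The slack between the length and \<open>L\<close> absorbs the \<open>n\<close> rounding
  pieces once \<open>N\<close> is at least \<open>n * L / (L - S)\<close>; zero letters fill the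
  word up to \<open>N\<close>.\<close>

lemma hprod_equalize:
  assumes "(\<Sum>j<n. norm (a j)) < L"
  shows "\<forall>\<^sub>F N in sequentially. \<exists>b. hprod b N = hprod a n \<and> (\<forall>j. norm (b j) \<le> L / real N)"
proof -
  define S where "S = (\<Sum>j<n. norm (a j))"
  have S: "0 \<le> S" "S < L" using assms by (auto simp: S_def intro: sum_nonneg)
  have "\<forall>\<^sub>F N in sequentially. real N \<ge> max 1 (real n * L / (L - S))"
    using filterlim_real_sequentially unfolding filterlim_at_top by blast
  then show ?thesis
  proof eventually_elim
    case (elim N)
    then have N: "N > 0" "real n * L / (L - S) \<le> real N" by auto
    have s: "L / real N > 0" using S N by simp
    obtain M b where b: "hprod b M = hprod a n" "\<And>j. norm (b j) \<le> L / real N"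
      "real M \<le> real n + S / (L / real N)"
      using hprod_refine[OF s, of a n] unfolding S_def by blast
    have "real n + S / (L / real N) \<le> real N"
      using N S by (simp add: field_simps)
    then have "M \<le> N" using b(3) by linarith
    have "hprod (\<lambda>j. if j < M then b j else 0) (M + (N - M)) = hprod a n"
      using hprod_append[of M b "\<lambda>_. 0" "N - M"] b(1) by (simp add: hprod_const flip: zero_prod_def)
    then show ?case
      using \<open>M \<le> N\<close> b(2) s by (intro exI[of _ "\<lambda>j. if j < M then b j else 0"]) auto
  qed
qed

text \<open>A bound on every letter, rather than on their sum, is what makes the energy
  \<open>N * \<Sum> |b j|^2\<close> at most \<open>L^2\<close>.\<close>

lemma near_optimal_word:
  assumes "dist_cc 0 w < L" "e > 0"
  shows "\<forall>\<^sub>F N in sequentially. \<exists>b. norm (hprod b N - w) < e \<and> (\<forall>j. norm (b j) \<le> L / real N)"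
proof -
  obtain L' where L': "dist_cc 0 w < L'" "L' < L" using dense assms by blast
  obtain \<gamma> u where h: "horiz_control B 0 w \<gamma> u" "(LINT t:{0..1}|lborel. norm (u t)) \<le> L'"
    using reach_near[OF L'(1)] by (auto simp: reach_def)
  obtain n a where na: "norm (hprod a n - w) < e" "(\<Sum>j<n. norm (a j)) \<le> (LINT t:{0..1}|lborel. norm (u t))"
    using control_polygon[OF h(1) assms(2)] by blast
  then have "(\<Sum>j<n. norm (a j)) < L" using h L' by linarith
  from hprod_equalize[OF this] show ?thesis
    by eventually_elim (metis na(1))
qed

end

subsection \<open>Weights annihilating the orbit of an orthogonal map\<close>

text \<open>Induction on the degree, splitting off one root \<open>z\<close> at a time. Multiplying
  by \<open>1 - c\<close>, where \<open>c\<close> averages the first \<open>a\<close> powers of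
  \<open>X / z\<close>, lengthens the support by \<open>a\<close>. If increments were at most
  \<open>D\<close>, the average of shifts adds at most \<open>D + 1 / a\<close>; the recursion
  \<open>D' = 2 * D + 1 / a\<close> starting from \<open>1 / a\<close> gives
  \<open>(2 ^ (d + 1) - 1) / a\<close>. Unimodularity keeps all coefficients of \<open>c\<close> of
  modulus \<open>1 / a\<close>.\<close>

lemma unimodular_multiple_slow_coeffs:
  fixes p :: "complex poly" and a :: nat
  assumes "p \<noteq> 0" and "\<And>z. poly p z = 0 \<Longrightarrow> norm z = 1" and "a \<ge> 1"
  shows "\<exists>g. p dvd g \<and> coeff g 0 = 1 \<and> (\<forall>k\<ge>(degree p + 1) * a. coeff g k = 0)
    \<and> (\<forall>k. norm (coeff g (Suc k) - coeff g k) \<le> (2 ^ (degree p + 1) - 1) / real a)"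
  using assms(1,2)
proof (induction "degree p" arbitrary: p)
  case 0
  define g :: "complex poly" where "g = (\<Sum>k<a. monom (of_real (1 - real k / real a)) k)"
  have c: "coeff g k = (if k < a then of_real (1 - real k / real a) else 0)" for k
    by (simp add: g_def coeff_sum coeff_monom)
  have "p dvd g"
    using 0 by (metis is_unit_iff_degree unit_imp_dvd)
  moreover have "norm (coeff g (Suc k) - coeff g k) \<le> 1 / real a" for k
  proof -
    consider "Suc k < a" | "Suc k = a" | "k \<ge> a" by linarith
    then show ?thesis
    proof cases
      case 1
      have "coeff g (Suc k) - coeff g k = of_real (- (1 / real a))"
        using 1 unfolding c by (simp add: field_simps flip: of_real_diff)
      then show ?thesis by (simp only: norm_of_real) simp
    next
      case 2
      then have "coeff g (Suc k) - coeff g k = of_real (- (1 / real a))"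
        using 2 unfolding c by (auto simp: field_simps)
      then show ?thesis by (simp only: norm_of_real) simp
    next
      case 3
      then show ?thesis by (simp add: c)
    qed
  qed
  ultimately show ?case
    using \<open>a \<ge> 1\<close> by (intro exI[of _ g]) (auto simp: c 0(1)[symmetric])
next
  case (Suc n)
  have "\<not> constant (poly p)"
    using Suc(2) by (simp add: constant_degree)
  then obtain z where z: "poly p z = 0"
    using fundamental_theorem_of_algebra by blast
  then obtain p' where p': "p = [:-z, 1:] * p'"
    by (auto simp: poly_eq_0_iff_dvd)
  have nz: "norm z = 1" using z Suc by blast
  have "p' \<noteq> 0" using Suc(3) p' by auto
  then have deg: "degree p = Suc (degree p')"
    unfolding p' by (subst degree_mult_eq) auto
  have "\<exists>g. p' dvd g \<and> coeff g 0 = 1 \<and> (\<forall>k\<ge>(degree p' + 1) * a. coeff g k = 0)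
    \<and> (\<forall>k. norm (coeff g (Suc k) - coeff g k) \<le> (2 ^ (degree p' + 1) - 1) / real a)"
    using Suc(2,4) \<open>p' \<noteq> 0\<close> deg by (intro Suc(1)) (auto simp: p')
  then obtain g' where g': "p' dvd g'" "coeff g' 0 = 1" "\<And>k. k \<ge> (degree p' + 1) * a \<Longrightarrow> coeff g' k = 0"
    "\<And>k. norm (coeff g' (Suc k) - coeff g' k) \<le> (2 ^ (degree p' + 1) - 1) / real a" by blast
  define D where "D = (2 ^ (degree p' + 1) - 1) / real a"
  have D0: "D \<ge> 0" unfolding D_def
    using one_le_power[of "2::real" "degree p' + 1"] by (intro divide_nonneg_nonneg) auto
  \<comment> \<open>\<open>c z = 1\<close>, and the small coefficients of \<open>c\<close> keep those of \<open>g' * (1 - c)\<close> slowly varying\<close>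
  define c :: "complex poly" where "c = (\<Sum>b\<in>{1..a}. monom (inverse z ^ b / of_nat a) b)"
  have "poly c z = (\<Sum>b\<in>{1..a}. 1 / of_nat a)"
    unfolding c_def poly_sum using nz
    by (intro sum.cong) (auto simp: poly_monom power_mult_distrib[symmetric] field_simps)
  then have "poly c z = 1" using \<open>a \<ge> 1\<close> by simp
  then have "[:-z, 1:] dvd (1 - c)" by (simp flip: poly_eq_0_iff_dvd)
  then have "p dvd g' * (1 - c)"
    unfolding p' using g'(1) by (metis mult.commute mult_dvd_mono)
  moreover
  have cf: "coeff (g' * (1 - c)) k = coeff g' k -
      (\<Sum>b\<in>{1..a}. if b \<le> k then inverse z ^ b / of_nat a * coeff g' (k - b) else 0)" for k
  proof -
    have "g' * (1 - c) = g' - c * g'" by (simp add: algebra_simps)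
    then show ?thesis by (auto simp: c_def sum_distrib_right coeff_sum coeff_monom_mult intro!: sum.cong)
  qed
  \<comment> \<open>\<open>c\<close> has no constant term, so the initial value 1 survives.\<close>
  have "coeff (g' * (1 - c)) 0 = 1"
    unfolding cf using g'(2) by (subst sum.neutral) auto
  moreover have "coeff (g' * (1 - c)) k = 0" if k: "k \<ge> (degree p + 1) * a" for k
  proof -
    have k': "k \<ge> (degree p' + 1) * a + a" using k deg by simp
    then have "coeff g' k = 0" by (intro g') auto
    moreover have "coeff g' (k - b) = 0" if "b \<in> {1..a}" for b
      using that k' by (intro g') auto
    ultimately show ?thesis unfolding cf by (subst sum.neutral) auto
  qed
  moreover have "norm (coeff (g' * (1 - c)) (Suc k) - coeff (g' * (1 - c)) k) \<le> (2 ^ (degree p + 1) - 1) / real a" for k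
  proof -
    let ?d = "\<lambda>b. (if b \<le> Suc k then coeff g' (Suc k - b) else 0) - (if b \<le> k then coeff g' (k - b) else 0)"
    \<comment> \<open>A shifted copy of \<open>g'\<close> varies slowly except where it starts,
      jumping from 0 to 1; for given \<open>k\<close> this happens only for the shift
      \<open>b = Suc k\<close>.\<close>
    have d: "norm (?d b) \<le> (if b = Suc k then 1 else 0) + D" for b
    proof -
      consider "b \<le> k" | "b = Suc k" | "b > Suc k" by linarith
      then show ?thesis
        using g'(4)[of "k - b"] g'(2) D0 by cases (auto simp: Suc_diff_le D_def)
    qed
    have "coeff (g' * (1 - c)) (Suc k) - coeff (g' * (1 - c)) k
       = (coeff g' (Suc k) - coeff g' k) - (\<Sum>b\<in>{1..a}. inverse z ^ b / of_nat a * ?d b)"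
    proof -
      have "(\<Sum>b\<in>{1..a}. inverse z ^ b / of_nat a * ?d b) =
        (\<Sum>b\<in>{1..a}. if b \<le> Suc k then inverse z ^ b / of_nat a * coeff g' (Suc k - b) else 0)
        - (\<Sum>b\<in>{1..a}. if b \<le> k then inverse z ^ b / of_nat a * coeff g' (k - b) else 0)"
        unfolding sum_subtractf[symmetric] by (intro sum.cong) (auto simp: algebra_simps)
      then show ?thesis unfolding cf by simp
    qed
    also have "norm \<dots> \<le> D + (\<Sum>b\<in>{1..a}. 1 / real a * ((if b = Suc k then 1 else 0) + D))"
    proof (rule order_trans[OF norm_triangle_ineq4 add_mono])
      show "norm (coeff g' (Suc k) - coeff g' k) \<le> D" using g'(4) by (simp add: D_def)
      show "norm (\<Sum>b\<in>{1..a}. inverse z ^ b / of_nat a * ?d b) \<le> (\<Sum>b\<in>{1..a}. 1 / real a * ((if b = Suc k then 1 else 0) + D))"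
      proof (rule sum_norm_le)
        fix b
        have "norm (inverse z ^ b / of_nat a :: complex) = 1 / real a"
          by (simp add: norm_divide norm_power norm_inverse nz)
        then show "norm (inverse z ^ b / of_nat a * ?d b) \<le> 1 / real a * ((if b = Suc k then 1 else 0) + D)"
          unfolding norm_mult by (simp only:) (intro mult_left_mono d, simp)
      qed
    qed
    also have "(\<Sum>b\<in>{1..a}. 1 / real a * ((if b = Suc k then 1 else 0) + D)) \<le> 1 / real a + D"
    proof -
      have "(\<Sum>b\<in>{1..a}. (if b = Suc k then 1 else 0) + D) \<le> 1 + real a * D"
        by (simp add: sum.distrib sum.delta)
      then have "1 / real a * (\<Sum>b\<in>{1..a}. (if b = Suc k then 1 else 0) + D) \<le> 1 / real a * (1 + real a * D)"
        by (intro mult_left_mono) auto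
      then show ?thesis using \<open>a \<ge> 1\<close> by (simp add: sum_distrib_left field_simps)
    qed
    also have "D + (1 / real a + D) = (2 ^ (degree p + 1) - 1) / real a"
      using \<open>a \<ge> 1\<close> by (simp add: D_def deg field_simps)
    finally show ?thesis by simp
  qed
  ultimately show ?case by blast
qed

text \<open>With \<open>U k = (R ^^ k) x\<close>, the choices \<open>Re\<close> and
  \<open>Im\<close> for \<open>c\<close> give the real and imaginary parts of \<open>p(R) x\<close>,
  so that complex polynomials act without forming the complexification of the space.\<close>

definition poly_orbit :: "(complex \<Rightarrow> real) \<Rightarrow> (nat \<Rightarrow> 'a::real_vector) \<Rightarrow> complex poly \<Rightarrow> 'a" where
  "poly_orbit c U p = (\<Sum>k\<le>degree p. c (coeff p k) *\<^sub>R U k)"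

lemma poly_orbit_eq:
  assumes "degree p \<le> n" "c 0 = 0"
  shows "poly_orbit c U p = (\<Sum>k\<le>n. c (coeff p k) *\<^sub>R U k)"
  unfolding poly_orbit_def using assms
  by (intro sum.mono_neutral_left) (auto simp: coeff_eq_0)

lemma poly_orbit_add:
  assumes "\<And>x y. c (x + y) = c x + c y"
  shows "poly_orbit c U (p + q) = poly_orbit c U p + poly_orbit c U q"
proof -
  have c0: "c 0 = 0" using assms[of 0 0] by simp
  let ?n = "max (degree p) (degree q)"
  have "degree (p + q) \<le> ?n" by (rule degree_add_le_max)
  then show ?thesis
    using c0 by (simp add: poly_orbit_eq[of _ ?n] assms scaleR_left_distrib sum.distrib)
qed

lemma poly_orbit_smult:
  "poly_orbit Re U (smult a p) = Re a *\<^sub>R poly_orbit Re U p - Im a *\<^sub>R poly_orbit Im U p"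
  "poly_orbit Im U (smult a p) = Re a *\<^sub>R poly_orbit Im U p + Im a *\<^sub>R poly_orbit Re U p"
  using degree_smult_le[of a p]
  by (simp_all add: poly_orbit_eq[of _ "degree p"] scaleR_sum_right scaleR_left_diff_distrib
      scaleR_left_distrib sum_subtractf sum.distrib)

lemma poly_orbit_shift:
  assumes "linear R" "c 0 = 0"
  shows "poly_orbit c (\<lambda>k. (R ^^ k) x) (pCons 0 p) = R (poly_orbit c (\<lambda>k. (R ^^ k) x) p)"
proof -
  have "poly_orbit c (\<lambda>k. (R ^^ k) x) (pCons 0 p)
      = (\<Sum>k\<le>Suc (degree p). c (coeff (pCons 0 p) k) *\<^sub>R (R ^^ k) x)"
    using assms(2) degree_pCons_le[of 0 p] by (intro poly_orbit_eq)
  also have "\<dots> = R (poly_orbit c (\<lambda>k. (R ^^ k) x) p)"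
    unfolding sum.atMost_Suc_shift poly_orbit_def
    using assms by (simp add: linear_sum linear_cmul)
  finally show ?thesis .
qed

text \<open>The polynomials annihilating \<open>x\<close> form an ideal: multiplication by the
  variable is application of \<open>R\<close>, and a complex scalar mixes the two parts.\<close>

lemma poly_orbit_mult_eq_0:
  fixes R :: "'a::real_vector \<Rightarrow> 'a"
  assumes "linear R" and "poly_orbit Re (\<lambda>k. (R ^^ k) x) p = 0" "poly_orbit Im (\<lambda>k. (R ^^ k) x) p = 0"
  shows "poly_orbit Re (\<lambda>k. (R ^^ k) x) (p * q) = 0 \<and> poly_orbit Im (\<lambda>k. (R ^^ k) x) (p * q) = 0"
proof (induction q)
  case 0
  then show ?case by (simp add: poly_orbit_def)
next
  case (pCons a q)
  then show ?case
    using assms by (simp add: poly_orbit_add poly_orbit_smult poly_orbit_shift[OF assms(1)] linear_0)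
qed

text \<open>Linear dependence is a property of sets, so a family with a repeated vector is treated
  apart, with coefficients 1 and -1.\<close>

lemma orbit_dependence:
  fixes U :: "nat \<Rightarrow> 'a::euclidean_space"
  shows "\<exists>c. (\<exists>k\<le>DIM('a). c k \<noteq> 0) \<and> (\<Sum>k\<le>DIM('a). c k *\<^sub>R U k) = 0"
proof (cases "inj_on U {..DIM('a)}")
  case True
  have "dependent (U ` {..DIM('a)})"
    using True by (intro dependent_biggerset) (simp add: card_image)
  then obtain u where u: "\<exists>v\<in>U ` {..DIM('a)}. u v \<noteq> 0" "(\<Sum>v\<in>U ` {..DIM('a)}. u v *\<^sub>R v) = 0"
    by (subst (asm) dependent_finite) auto
  then show ?thesis
    using True by (intro exI[of _ "\<lambda>k. u (U k)"]) (auto simp: sum.reindex)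
next
  case False
  then obtain i j where ij: "i \<le> DIM('a)" "j \<le> DIM('a)" "i \<noteq> j" "U i = U j"
    by (auto simp: inj_on_def)
  define c :: "nat \<Rightarrow> real" where "c k = (if k = i then 1 else 0) - (if k = j then 1 else 0)" for k
  have "(\<Sum>k\<le>DIM('a). c k *\<^sub>R U k) = (\<Sum>k\<le>DIM('a). if k = i then U k else 0) - (\<Sum>k\<le>DIM('a). if k = j then U k else 0)"
    unfolding sum_subtractf[symmetric] by (intro sum.cong) (auto simp: c_def)
  also have "\<dots> = 0" using ij by simp
  finally show ?thesis
    using ij by (intro exI[of _ c]) (auto simp: c_def)
qed

text \<open>For an annihilator \<open>p\<close> of least degree and a root \<open>z\<close>, the
  cofactor \<open>q\<close> does not annihilate \<open>x\<close>. Then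
  \<open>q(R) x = v + i w\<close> is an eigenvector of \<open>R\<close> for \<open>z\<close>, and
  since \<open>R\<close> preserves norms, \<open>|z| = 1\<close>.\<close>

lemma orthogonal_annihilator:
  fixes R :: "'a::euclidean_space \<Rightarrow> 'a"
  assumes R: "orthogonal_transformation R"
  obtains p where "p \<noteq> 0" "degree p \<le> DIM('a)" "\<And>z. poly p z = 0 \<Longrightarrow> norm z = 1"
    "poly_orbit Re (\<lambda>k. (R ^^ k) x) p = 0" "poly_orbit Im (\<lambda>k. (R ^^ k) x) p = 0"
proof -
  let ?U = "\<lambda>k. (R ^^ k) x"
  have lin: "linear R" using R by (rule orthogonal_transformation_linear)
  define P where "P p \<longleftrightarrow> p \<noteq> 0 \<and> poly_orbit Re ?U p = 0 \<and> poly_orbit Im ?U p = 0" for p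
  obtain c where c: "\<exists>k\<le>DIM('a). c k \<noteq> 0" "(\<Sum>k\<le>DIM('a). c k *\<^sub>R ?U k) = 0"
    using orbit_dependence[of ?U] by blast
  define p0 :: "complex poly" where "p0 = (\<Sum>k\<le>DIM('a). monom (of_real (c k)) k)"
  have cf: "coeff p0 k = (if k \<le> DIM('a) then of_real (c k) else 0)" for k
    by (simp add: p0_def coeff_sum)
  have d0: "degree p0 \<le> DIM('a)" by (intro degree_le) (simp add: cf)
  have "p0 \<noteq> 0" using c(1) cf by (metis coeff_0 of_real_eq_0_iff)
  then have P0: "P p0"
    using c(2) by (simp add: P_def poly_orbit_eq[OF d0] cf)
  obtain p where p: "P p" and min: "\<And>q. P q \<Longrightarrow> degree p \<le> degree q"
    using ex_has_least_nat[of P p0 degree] P0 by blast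
  show ?thesis
  proof
    show "p \<noteq> 0" "poly_orbit Re ?U p = 0" "poly_orbit Im ?U p = 0"
      using p by (auto simp: P_def)
    show "degree p \<le> DIM('a)" using min[OF P0] d0 by simp
    fix z assume "poly p z = 0"
    then obtain q where q: "p = [:-z, 1:] * q" by (auto simp: poly_eq_0_iff_dvd)
    have "q \<noteq> 0" using \<open>p \<noteq> 0\<close> q by auto
    then have "degree p = Suc (degree q)"
      unfolding q by (subst degree_mult_eq) auto
    then have "\<not> P q" using min[of q] by auto
    define v where "v = poly_orbit Re ?U q"
    define w where "w = poly_orbit Im ?U q"
    have nz: "v \<noteq> 0 \<or> w \<noteq> 0" using \<open>\<not> P q\<close> \<open>q \<noteq> 0\<close> by (auto simp: P_def v_def w_def)
    have pq: "p = pCons 0 q + smult (- z) q" unfolding q by simp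
    \<comment> \<open>The real and imaginary parts of \<open>(R - z) (v + i w) = 0\<close>.\<close>
    have "R v + ((- Re z) *\<^sub>R v - (- Im z) *\<^sub>R w) = 0" "R w + ((- Re z) *\<^sub>R w + (- Im z) *\<^sub>R v) = 0"
      using p unfolding P_def pq v_def w_def
      by (simp_all only: poly_orbit_add poly_orbit_smult poly_orbit_shift[OF lin] plus_complex.sel
          zero_complex.sel uminus_complex.sel)
    then have "R v = Re z *\<^sub>R v - Im z *\<^sub>R w" "R w = Re z *\<^sub>R w + Im z *\<^sub>R v"
      by (simp_all add: algebra_simps add_eq_0_iff)
    then have "norm (Re z *\<^sub>R v - Im z *\<^sub>R w) = norm v" "norm (Re z *\<^sub>R w + Im z *\<^sub>R v) = norm w"
      using R by (metis orthogonal_transformation_norm)+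
    then have "(norm (Re z *\<^sub>R v - Im z *\<^sub>R w))\<^sup>2 + (norm (Re z *\<^sub>R w + Im z *\<^sub>R v))\<^sup>2
        = (norm v)\<^sup>2 + (norm w)\<^sup>2" by simp
    moreover have "(norm (Re z *\<^sub>R v - Im z *\<^sub>R w))\<^sup>2 + (norm (Re z *\<^sub>R w + Im z *\<^sub>R v))\<^sup>2
        = (norm z)\<^sup>2 * ((norm v)\<^sup>2 + (norm w)\<^sup>2)"
      unfolding cmod_power2 power2_norm_eq_inner
      by (simp add: inner_simps algebra_simps inner_commute power2_eq_square)
    moreover have "(norm v)\<^sup>2 + (norm w)\<^sup>2 \<noteq> 0"
      using nz by (simp add: sum_power2_eq_zero_iff)
    ultimately have "(norm z)\<^sup>2 = 1" by (metis mult_cancel_right1)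
    then show "norm z = 1" by (simp add: power2_eq_1_iff) (use norm_ge_zero[of z] in linarith)
  qed
qed

text \<open>The orbit vectors are real, so the real parts of the coefficients of a multiple of the
  annihilator already give a vanishing combination. The annihilator has degree at most the dimension
  for every \<open>R\<close>, hence a bound that does not see \<open>R\<close>.\<close>

lemma orthogonal_orbit_weights:
  fixes R :: "'a::euclidean_space \<Rightarrow> 'a"
  assumes R: "orthogonal_transformation R" and N: "N \<ge> DIM('a) + 1"
  obtains g :: "nat \<Rightarrow> real" where "g 0 = 1" "\<And>k. k \<ge> N \<Longrightarrow> g k = 0"
    "\<And>k. \<bar>g (Suc k) - g k\<bar> \<le> 2 * (real DIM('a) + 1) * 2 ^ (DIM('a) + 1) / real N"
    "(\<Sum>k<N. g k *\<^sub>R (R ^^ k) x) = 0"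
proof -
  obtain p where p: "p \<noteq> 0" "degree p \<le> DIM('a)" "\<And>z. poly p z = 0 \<Longrightarrow> norm z = 1"
    "poly_orbit Re (\<lambda>k. (R ^^ k) x) p = 0" "poly_orbit Im (\<lambda>k. (R ^^ k) x) p = 0"
    using orthogonal_annihilator[OF R] by blast
  \<comment> \<open>The largest step for which the support, of length at most
    \<open>(DIM + 1) * a\<close>, fits below \<open>N\<close>. Rounding down loses at most a factor
    2, the leading factor 2 of the bound.\<close>
  define a where "a = N div (DIM('a) + 1)"
  have a: "a \<ge> 1" unfolding a_def using N by (simp add: Suc_leI div_greater_zero_iff)
  have aN: "(DIM('a) + 1) * a \<le> N" unfolding a_def by (rule times_div_less_eq_dividend)
  have "N < (DIM('a) + 1) * (a + 1)"
    unfolding a_def using dividend_less_times_div[of "DIM('a) + 1" N] by simp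
  also have "\<dots> \<le> (DIM('a) + 1) * (2 * a)" using a by (intro mult_left_mono) auto
  finally have "real N \<le> real ((DIM('a) + 1) * (2 * a))" by linarith
  then have Na: "1 / real a \<le> 2 * (real DIM('a) + 1) / real N"
    using a N by (simp add: field_simps)
  obtain G where G: "p dvd G" "coeff G 0 = 1" "\<And>k. k \<ge> (degree p + 1) * a \<Longrightarrow> coeff G k = 0"
    "\<And>k. norm (coeff G (Suc k) - coeff G k) \<le> (2 ^ (degree p + 1) - 1) / real a"
    using unimodular_multiple_slow_coeffs[OF p(1,3) a] by blast
  show ?thesis
  proof (rule that[of "\<lambda>k. Re (coeff G k)"])
    have G0: "coeff G k = 0" if "k \<ge> N" for k
    proof (rule G(3))
      have "(degree p + 1) * a \<le> (DIM('a) + 1) * a" using p(2) by (intro mult_right_mono) auto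
      then show "(degree p + 1) * a \<le> k" using that aN by linarith
    qed
    then show "Re (coeff G k) = 0" if "k \<ge> N" for k using that by simp
    show "Re (coeff G 0) = 1" using G by simp
    show "\<bar>Re (coeff G (Suc k)) - Re (coeff G k)\<bar> \<le> 2 * (real DIM('a) + 1) * 2 ^ (DIM('a) + 1) / real N" for k
    proof -
      have "\<bar>Re (coeff G (Suc k)) - Re (coeff G k)\<bar> \<le> norm (coeff G (Suc k) - coeff G k)"
        using abs_Re_le_cmod[of "coeff G (Suc k) - coeff G k"] by simp
      also have "\<dots> \<le> (2 ^ (degree p + 1) - 1) * (1 / real a)" using G(4) by simp
      also have "\<dots> \<le> 2 ^ (DIM('a) + 1) * (2 * (real DIM('a) + 1) / real N)"
      proof (rule mult_mono[OF _ Na])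
        have "(2::real) ^ (degree p + 1) \<le> 2 ^ (DIM('a) + 1)" using p(2) by (intro power_increasing) auto
        then show "(2::real) ^ (degree p + 1) - 1 \<le> 2 ^ (DIM('a) + 1)" by linarith
      qed auto
      finally show ?thesis by (simp add: mult_ac)
    qed
    obtain q where "G = p * q" using G(1) by (elim dvdE)
    then have "poly_orbit Re (\<lambda>k. (R ^^ k) x) G = 0"
      using poly_orbit_mult_eq_0[OF orthogonal_transformation_linear[OF R] p(4,5)] by blast
    moreover have "degree G \<le> N" using G0 by (intro degree_le) auto
    ultimately have "(\<Sum>k\<le>N. Re (coeff G k) *\<^sub>R (R ^^ k) x) = 0"
      by (simp add: poly_orbit_eq)
    then show "(\<Sum>k<N. Re (coeff G k) *\<^sub>R (R ^^ k) x) = 0"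
      using G0[of N] by (simp add: lessThan_Suc_atMost[symmetric])
  qed
qed

subsection \<open>Rotating words and their perturbations\<close>

text \<open>The first-order condition at a minimum of a quadratic; the test value
  \<open>s = - p / (q + 1)\<close> also works when \<open>q = 0\<close>.\<close>

lemma linear_coeff_eq_0:
  fixes p q :: real
  assumes "\<And>s. 0 \<le> s * p + s\<^sup>2 * q" "q \<ge> 0"
  shows "p = 0"
proof (rule ccontr)
  assume "p \<noteq> 0"
  define t where "t = p / (q + 1)"
  have p: "p = t * (q + 1)" using assms(2) by (simp add: t_def)
  have "(- t) * p + (- t)\<^sup>2 * q = - t\<^sup>2"
    unfolding p by (simp add: algebra_simps power2_eq_square)
  moreover have "t\<^sup>2 > 0" using \<open>p \<noteq> 0\<close> p by auto
  ultimately show False using assms(1)[of "- t"] by linarith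
qed

lemma sum_pairs: "(\<Sum>j<2 * n. F j) = (\<Sum>k<n. F (2 * k) + F (2 * k + 1))" for F :: "nat \<Rightarrow> 'a::comm_monoid_add"
  by (induction n) (auto simp: add_ac)

text \<open>\<open>R\<close> is the Cayley transform of \<open>A\<close>. Skewness gives
  \<open>(x + A x) \<bullet> x = x \<bullet> x\<close>, hence invertibility of \<open>1 + A\<close>;
  and \<open>R x - x = - A (R x + x)\<close> is orthogonal to \<open>R x + x\<close>, hence
  \<open>|R x| = |x|\<close>.\<close>

lemma cayley_orbit:
  fixes A :: "'a::euclidean_space \<Rightarrow> 'a"
  assumes lin: "linear A" and skew: "\<And>x. A x \<bullet> x = 0"
  obtains R where "orthogonal_transformation R" "\<And>x y. y - x + A (x + y) = 0 \<Longrightarrow> y = R x"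
proof -
  define P where "P x = x + A x" for x
  define Q where "Q x = x - A x" for x
  have linP: "linear P" and linQ: "linear Q"
    using lin by (auto simp: P_def[abs_def] Q_def[abs_def] intro!: linear_compose_add linear_compose_sub linear_ident)
  have "x = 0" if "P x = 0" for x
  proof -
    have "P x \<bullet> x = x \<bullet> x" by (simp add: P_def inner_add_left skew)
    then show ?thesis using that by simp
  qed
  then have inj: "inj P" using linP linear_injective_0 by blast
  obtain P' where P': "linear P'" "P' \<circ> P = id"
    using linear_injective_left_inverse[OF linP inj] by blast
  have surj: "surj P" using linP inj linear_injective_imp_surjective by blast
  have PP': "P (P' y) = y" for y
    using P'(2) surj by (metis comp_apply id_apply surj_def)
  define R where "R = P' \<circ> Q"
  have linR: "linear R" unfolding R_def by (rule linear_compose[OF linQ P'(1)])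
  have "norm (R x) = norm x" for x
  proof -
    have "P (R x) = Q x" by (simp add: R_def PP')
    then have "R x - x = - A (R x + x)"
      using lin by (simp add: P_def Q_def linear_add algebra_simps)
    then have "(R x - x) \<bullet> (R x + x) = 0" by (simp add: skew)
    then have "R x \<bullet> R x = x \<bullet> x" by (simp add: inner_simps inner_commute)
    then show ?thesis by (simp add: norm_eq)
  qed
  with linR have "orthogonal_transformation R" by (simp add: orthogonal_transformation)
  moreover have "y = R x" if "y - x + A (x + y) = 0" for x y
  proof -
    have "P y = Q x" using that lin by (simp add: P_def Q_def linear_add algebra_simps)
    then show ?thesis using P'(2) by (metis R_def comp_apply id_apply)
  qed
  ultimately show ?thesis by (rule that)
qed

context step2_group
begin

text \<open>The factor \<open>N\<close> makes the energy of a word with letters of equal norm the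
  square of its length.\<close>

definition penalty :: "real \<Rightarrow> (real^'m) \<times> (real^'k) \<Rightarrow> nat \<Rightarrow> (nat \<Rightarrow> real^'m) \<Rightarrow> real" where
  "penalty \<kappa> w N a = real N * (\<Sum>k<N. (norm (a k))\<^sup>2) + \<kappa> * (norm (hprod a N - w))\<^sup>2"

lemma continuous_hprod: "continuous_on UNIV (\<lambda>a. hprod a n)"
proof (induction n)
  case (Suc n)
  then show ?case
    unfolding hprod.simps gmult_def
    by (intro continuous_on_Pair continuous_on_add continuous_on_fst continuous_on_snd
        B.continuous_on continuous_on_product_coordinates continuous_on_const)
qed simp

lemma penalty_minimiser:
  assumes N: "N > 0" and \<kappa>: "\<kappa> \<ge> 0"
  obtains a where "\<And>b. penalty \<kappa> w N a \<le> penalty \<kappa> w N b"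
proof -
  \<comment> \<open>A word with a letter longer than \<open>r\<close> already costs more than the
    zero word.\<close>
  define r where "r = sqrt (penalty \<kappa> w N (\<lambda>_. 0))"
  have p0: "penalty \<kappa> w N b \<ge> 0" for b
    using \<kappa> by (auto simp: penalty_def intro!: add_nonneg_nonneg mult_nonneg_nonneg sum_nonneg)
  have r: "r \<ge> 0" by (simp add: r_def p0)
  \<comment> \<open>Letters from \<open>N\<close> on do not enter the penalty and are frozen at 0;
    the resulting product set is compact by Tychonoff.\<close>
  define S where "S = (\<lambda>k::nat. if k < N then cball (0::real^'m) r else {0})"
  have "compactin (product_topology (\<lambda>_. euclidean) UNIV) (PiE UNIV S)"
    unfolding compactin_PiE by (auto simp: S_def)
  then have comp: "compact (PiE UNIV S)"
    by (simp add: euclidean_product_topology)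
  have cont: "continuous_on (PiE UNIV S) (penalty \<kappa> w N)"
    unfolding penalty_def[abs_def]
    by (rule continuous_on_subset[OF _ subset_UNIV])
      (intro continuous_intros continuous_on_product_coordinates continuous_hprod)
  have zero: "(\<lambda>_. 0) \<in> PiE UNIV S" using r by (auto simp: S_def)
  then have "PiE UNIV S \<noteq> {}" by blast
  from continuous_attains_inf[OF comp this cont] obtain a where a: "a \<in> PiE UNIV S" "\<And>b. b \<in> PiE UNIV S \<Longrightarrow> penalty \<kappa> w N a \<le> penalty \<kappa> w N b"
    by blast
  have "penalty \<kappa> w N a \<le> penalty \<kappa> w N b" for b
  proof (cases "\<forall>k<N. norm (b k) \<le> r")
    case True
    define b' where "b' k = (if k < N then b k else 0)" for k
    have "penalty \<kappa> w N b' = penalty \<kappa> w N b"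
      using hprod_cong[of N b' b] by (simp add: penalty_def b'_def)
    moreover have "b' \<in> PiE UNIV S" using True by (auto simp: S_def b'_def)
    ultimately show ?thesis using a(2) by metis
  next
    case False
    then obtain k where k: "k < N" "norm (b k) > r" by auto
    have "penalty \<kappa> w N (\<lambda>_. 0) = r\<^sup>2" by (simp add: r_def p0)
    also have "\<dots> \<le> (norm (b k))\<^sup>2" using k r by (intro power_mono) auto
    also have "\<dots> \<le> (\<Sum>k<N. (norm (b k))\<^sup>2)" using k by (intro member_le_sum) auto
    also have "\<dots> \<le> real N * (\<Sum>k<N. (norm (b k))\<^sup>2)"
      using N mult_right_mono[of 1 "real N" "\<Sum>k<N. (norm (b k))\<^sup>2"] by (simp add: sum_nonneg)
    also have "\<dots> \<le> penalty \<kappa> w N b" using \<kappa> by (simp add: penalty_def)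
    finally show ?thesis using a(2)[OF zero] by simp
  qed
  then show ?thesis by (rule that)
qed

text \<open>The vertical part of a word is the sum of \<open>B (a i) (a j)\<close> over
  \<open>i < j\<close>, hence affine in each single letter. The penalty is therefore exactly
  quadratic in \<open>s\<close>.\<close>

lemma hprod_update:
  assumes "k < n"
  shows "hprod (a(k := a k + s *\<^sub>R v)) n = hprod a n + s *\<^sub>R (v, B (\<Sum>j<k. a j) v + B v (\<Sum>j\<in>{k<..<n}. a j))"
  using assms
proof (induction n)
  case (Suc n)
  show ?case
  proof (cases "k = n")
    case True
    define b where "b = a(k := a k + s *\<^sub>R v)"
    have "hprod b n = hprod a n"
      using True by (intro hprod_cong) (auto simp: b_def)
    moreover have "b n = a n + s *\<^sub>R v" using True by (simp add: b_def)
    moreover have "{k<..<Suc n} = {}" using True by auto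
    ultimately show ?thesis
      unfolding b_def[symmetric] using True
      by (simp add: gmult_def fst_hprod B.add_right B.scaleR_right B.zero_right)
  next
    case False
    then have "k < n" using Suc by simp
    then have "{k<..<Suc n} = insert n {k<..<n}" by auto
    with Suc \<open>k < n\<close> show ?thesis
      by (simp add: gmult_def B.add_left B.add_right B.scaleR_left B.scaleR_right algebra_simps)
  qed
qed simp

text \<open>The multiplier is \<open>\<kappa>\<close> times the endpoint error \<open>\<xi>\<close>.
  Subtracting the Euler-Lagrange equations of two consecutive letters leaves only the vertical part
  of \<open>\<xi>\<close>, tested against \<open>B (a k + a (Suc k))\<close>, which is the Cayley
  relation.\<close>

lemma penalty_minimiser_rotates:
  assumes N: "N > 0" and \<kappa>: "\<kappa> \<ge> 0" and min: "\<And>b. penalty \<kappa> w N a \<le> penalty \<kappa> w N b"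
  obtains R where "orthogonal_transformation R" "\<And>k. k < N \<Longrightarrow> a k = (R ^^ k) (a 0)"
proof -
  define \<xi> where "\<xi> = hprod a N - w"
  define G where "G k v = (v, B (\<Sum>j<k. a j) v + B v (\<Sum>j\<in>{k<..<N}. a j))" for k v
  have EL: "real N * (a k \<bullet> v) + \<kappa> * (\<xi> \<bullet> G k v) = 0" if k: "k < N" for k v
  proof -
    have "2 * (real N * (a k \<bullet> v) + \<kappa> * (\<xi> \<bullet> G k v)) = 0"
    proof (rule linear_coeff_eq_0)
      show "0 \<le> real N * (norm v)\<^sup>2 + \<kappa> * (norm (G k v))\<^sup>2" using \<kappa> by simp
      fix s
      define b where "b = a(k := a k + s *\<^sub>R v)"
      have "hprod b N - w = \<xi> + s *\<^sub>R G k v"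
        unfolding b_def hprod_update[OF k] \<xi>_def G_def by simp
      then have 1: "(norm (hprod b N - w))\<^sup>2 = (norm \<xi>)\<^sup>2 + s * (2 * (\<xi> \<bullet> G k v)) + s\<^sup>2 * (norm (G k v))\<^sup>2"
        unfolding power2_norm_eq_inner
        by (simp add: inner_add_left inner_add_right inner_commute power2_eq_square)
      have "(\<Sum>j<N. (norm (b j))\<^sup>2) = (norm (b k))\<^sup>2 + (\<Sum>j\<in>{..<N} - {k}. (norm (b j))\<^sup>2)"
        using k by (intro sum.remove) auto
      also have "(\<Sum>j\<in>{..<N} - {k}. (norm (b j))\<^sup>2) = (\<Sum>j\<in>{..<N} - {k}. (norm (a j))\<^sup>2)"
        by (intro sum.cong) (auto simp: b_def)
      also have "(norm (b k))\<^sup>2 = (norm (a k))\<^sup>2 + s * (2 * (a k \<bullet> v)) + s\<^sup>2 * (norm v)\<^sup>2"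
        unfolding power2_norm_eq_inner b_def
        by (simp add: inner_add_left inner_add_right inner_commute power2_eq_square)
      also have "\<dots> + (\<Sum>j\<in>{..<N} - {k}. (norm (a j))\<^sup>2)
          = (\<Sum>j<N. (norm (a j))\<^sup>2) + s * (2 * (a k \<bullet> v)) + s\<^sup>2 * (norm v)\<^sup>2"
        using k by (subst (2) sum.remove[of _ k]) auto
      finally have 2: "(\<Sum>j<N. (norm (b j))\<^sup>2) = (\<Sum>j<N. (norm (a j))\<^sup>2) + s * (2 * (a k \<bullet> v)) + s\<^sup>2 * (norm v)\<^sup>2" .
      have "penalty \<kappa> w N b = penalty \<kappa> w N a + (s * (2 * (real N * (a k \<bullet> v) + \<kappa> * (\<xi> \<bullet> G k v)))
          + s\<^sup>2 * (real N * (norm v)\<^sup>2 + \<kappa> * (norm (G k v))\<^sup>2))"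
        unfolding penalty_def 1 2 \<xi>_def[symmetric] by (simp add: algebra_simps)
      with min[of b] show "0 \<le> s * (2 * (real N * (a k \<bullet> v) + \<kappa> * (\<xi> \<bullet> G k v)))
          + s\<^sup>2 * (real N * (norm v)\<^sup>2 + \<kappa> * (norm (G k v))\<^sup>2)" by simp
    qed
    then show ?thesis by simp
  qed
  \<comment> \<open>The linear map representing the skew form
    \<open>(x, v) \<mapsto> \<kappa> / N * (snd \<xi> \<bullet> B x v)\<close>.\<close>
  define A where "A x = (\<Sum>i\<in>Basis. (\<kappa> / real N * (snd \<xi> \<bullet> B x i)) *\<^sub>R i)" for x
  have A: "A x \<bullet> v = \<kappa> / real N * (snd \<xi> \<bullet> B x v)" for x v
  proof -
    have "B x v = (\<Sum>i\<in>Basis. (v \<bullet> i) *\<^sub>R B x i)"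
      by (subst euclidean_representation[of v, symmetric]) (simp add: B.sum_right B.scaleR_right)
    then show ?thesis
      by (simp add: A_def inner_sum_left inner_sum_right sum_distrib_left inner_commute mult_ac)
  qed
  have "linear A"
    by (rule linearI; subst vector_eq_rdot[symmetric])
      (simp_all add: A inner_add_left inner_add_right B.add_left B.scaleR_left distrib_left)
  moreover have "A x \<bullet> x = 0" for x by (simp add: A)
  ultimately obtain R where R: "orthogonal_transformation R" "\<And>x y. y - x + A (x + y) = 0 \<Longrightarrow> y = R x"
    using cayley_orbit by blast
  have step: "a (Suc k) = R (a k)" if k: "Suc k < N" for k
  proof (rule R(2))
    have "(a (Suc k) - a k + A (a k + a (Suc k))) \<bullet> v = 0" for v
    proof -
      have "{k<..<N} = insert (Suc k) {Suc k<..<N}" using k by auto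
      \<comment> \<open>From \<open>k\<close> to \<open>Suc k\<close>, the letter \<open>a k\<close>
        joins the left sum and \<open>a (Suc k)\<close> leaves the right one.\<close>
      then have "G (Suc k) v - G k v = (0, B (a k) v - B v (a (Suc k)))"
        by (simp add: G_def B.add_left B.add_right)
      also have "\<dots> = (0, B (a k + a (Suc k)) v)"
        using skew[of v "a (Suc k)"] by (simp add: B.add_left)
      finally have "\<xi> \<bullet> G (Suc k) v - \<xi> \<bullet> G k v = snd \<xi> \<bullet> B (a k + a (Suc k)) v"
        unfolding inner_diff_right[symmetric] by (simp add: inner_prod_def)
      then have "\<kappa> * (\<xi> \<bullet> G (Suc k) v) - \<kappa> * (\<xi> \<bullet> G k v) = \<kappa> * (snd \<xi> \<bullet> B (a k + a (Suc k)) v)"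
        by (metis right_diff_distrib)
      with EL[of k v] EL[of "Suc k" v] k
      have "real N * (a (Suc k) \<bullet> v) - real N * (a k \<bullet> v) + \<kappa> * (snd \<xi> \<bullet> B (a k + a (Suc k)) v) = 0" by simp
      then have "real N * ((a (Suc k) - a k + A (a k + a (Suc k))) \<bullet> v) = 0"
        using N by (simp add: inner_add_left inner_diff_left A algebra_simps)
      then show ?thesis using N by simp
    qed
    then show "a (Suc k) - a k + A (a k + a (Suc k)) = 0"
      using inner_eq_zero_iff by blast
  qed
  have "a k = (R ^^ k) (a 0)" if "k < N" for k
    using that
  proof (induction k)
    case (Suc k)
    then show ?case using step[of k] by simp
  qed simp
  with R(1) show ?thesis by (rule that)
qed

text \<open>The minimiser is compared with an almost optimal word \<open>b\<close>, whose penalty is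
  at most \<open>L1^2 + \<kappa> * \<delta>^2 = L^2\<close>. The energy term then bounds the common
  letter norm and the penalty term the endpoint error.\<close>

lemma near_optimal_rotating_word:
  assumes L: "dist_cc 0 w < L" and e: "e > 0"
  shows "\<forall>\<^sub>F N in sequentially. \<exists>(R :: real^'m \<Rightarrow> real^'m) x. orthogonal_transformation R
    \<and> norm (hprod (\<lambda>k. (R ^^ k) x) N - w) < e \<and> norm x \<le> L / real N"
proof -
  obtain L1 where L1: "dist_cc 0 w < L1" "L1 < L" using dense L by blast
  have L0: "0 < L1" using L1 cc_dist_nonneg[of 0 w] by linarith
  \<comment> \<open>Large enough that an endpoint error of \<open>e\<close> alone would cost more
    than \<open>L^2\<close>. It is fixed before \<open>N\<close>.\<close>
  define \<kappa> where "\<kappa> = L\<^sup>2 / e\<^sup>2 + 1"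
  have \<kappa>: "\<kappa> > 0" "\<kappa> * e\<^sup>2 > L\<^sup>2"
    using e by (auto simp: \<kappa>_def field_simps add_nonneg_pos)
  have LL: "L1\<^sup>2 < L\<^sup>2" using L0 L1 by (intro power_strict_mono) auto
  define \<delta> where "\<delta> = sqrt ((L\<^sup>2 - L1\<^sup>2) / \<kappa>)"
  have \<delta>: "\<delta> > 0" "\<kappa> * \<delta>\<^sup>2 = L\<^sup>2 - L1\<^sup>2"
    using \<kappa> LL by (auto simp: \<delta>_def)
  have "\<forall>\<^sub>F N in sequentially. \<exists>b. norm (hprod b N - w) < \<delta> \<and> (\<forall>j. norm (b j) \<le> L1 / real N)"
    using near_optimal_word[OF L1(1) \<delta>(1)] .
  then show ?thesis
    using eventually_gt_at_top[of 0]
  proof eventually_elim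
    case (elim N)
    then have N: "N > 0" by simp
    obtain b where b: "norm (hprod b N - w) < \<delta>" "\<And>j. norm (b j) \<le> L1 / real N" using elim by blast
    obtain a where min: "\<And>b. penalty \<kappa> w N a \<le> penalty \<kappa> w N b"
      using penalty_minimiser[OF N, of \<kappa> w] \<kappa>(1) by (metis less_imp_le)
    obtain R where R: "orthogonal_transformation R" "\<And>k. k < N \<Longrightarrow> a k = (R ^^ k) (a 0)"
      using penalty_minimiser_rotates[OF N _ min] \<kappa>(1) by (metis less_imp_le)
    have "(\<Sum>k<N. (norm (b k))\<^sup>2) \<le> (\<Sum>k<N. (L1 / real N)\<^sup>2)"
      by (intro sum_mono power_mono b) auto
    then have "real N * (\<Sum>k<N. (norm (b k))\<^sup>2) \<le> real N * (\<Sum>k<N. (L1 / real N)\<^sup>2)"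
      by (intro mult_left_mono) auto
    also have "\<dots> = L1\<^sup>2" using N by (simp add: power2_eq_square)
    finally have "real N * (\<Sum>k<N. (norm (b k))\<^sup>2) \<le> L1\<^sup>2" .
    moreover have "\<kappa> * (norm (hprod b N - w))\<^sup>2 \<le> \<kappa> * \<delta>\<^sup>2"
      using b \<kappa> by (intro mult_left_mono power_mono) auto
    ultimately have "penalty \<kappa> w N a \<le> L\<^sup>2"
      using min[of b] \<delta>(2) by (simp add: penalty_def)
    moreover have "(\<Sum>k<N. (norm (a k))\<^sup>2) = real N * (norm (a 0))\<^sup>2"
    proof -
      have eq: "norm (a k) = norm (a 0)" if "k < N" for k
      proof -
        have "norm ((R ^^ k) x) = norm x" for x
          by (induction k) (simp_all add: orthogonal_transformation_norm[OF R(1)])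
        then show ?thesis using R(2)[OF that] by metis
      qed
      have "(\<Sum>k<N. (norm (a k))\<^sup>2) = (\<Sum>k<N. (norm (a 0))\<^sup>2)"
        by (rule sum.cong[OF refl]) (metis lessThan_iff eq)
      then show ?thesis by simp
    qed
    ultimately have "(real N * norm (a 0))\<^sup>2 + \<kappa> * (norm (hprod a N - w))\<^sup>2 \<le> L\<^sup>2"
      by (simp add: penalty_def power2_eq_square mult_ac)
    moreover have "0 \<le> \<kappa> * (norm (hprod a N - w))\<^sup>2" using \<kappa> by simp
    moreover have "0 \<le> (real N * norm (a 0))\<^sup>2" by simp
    ultimately have 1: "(real N * norm (a 0))\<^sup>2 \<le> L\<^sup>2" and 2: "\<kappa> * (norm (hprod a N - w))\<^sup>2 \<le> L\<^sup>2"
      by linarith+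
    have "real N * norm (a 0) \<le> L" using 1 L0 L1 by (intro power2_le_imp_le[OF 1]) auto
    then have "norm (a 0) \<le> L / real N" using N by (simp add: field_simps)
    moreover have "norm (hprod a N - w) < e"
    proof (rule ccontr)
      assume "\<not> norm (hprod a N - w) < e"
      then have "e\<^sup>2 \<le> (norm (hprod a N - w))\<^sup>2" using e by (intro power_mono) auto
      then have "\<kappa> * e\<^sup>2 \<le> \<kappa> * (norm (hprod a N - w))\<^sup>2" using \<kappa> by (intro mult_left_mono) auto
      then show False using 2 \<kappa>(2) by linarith
    qed
    moreover have "hprod a N = hprod (\<lambda>k. (R ^^ k) (a 0)) N"
      using R(2) by (intro hprod_cong)
    ultimately show ?case
      using R(1) by (intro exI[of _ R] exI[of _ "a 0"] conjI) simp_all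
  qed
qed

text \<open>Terms quadratic in \<open>h\<close> vanish because \<open>B h h = 0\<close>. The terms
  linear in \<open>h\<close> beyond those of the left product combine, by skewness and summation by
  parts, into \<open>B\<close> of the sum in \<open>orth\<close> against \<open>h\<close>.\<close>

lemma hprod_perturb:
  assumes f: "f 0 = 1" "f M = 0" and orth: "(\<Sum>j<M. (f j + f (Suc j)) *\<^sub>R a j) = 0"
  shows "hprod (\<lambda>j. a j + (f j - f (Suc j)) *\<^sub>R h) M = (h, 0) \<star> hprod a M"
proof -
  define S where "S n = (\<Sum>j<n. a j)" for n
  have S: "S (Suc n) = S n + a n" "S 0 = 0" for n by (simp_all add: S_def)
  have gen: "hprod (\<lambda>j. a j + (f j - f (Suc j)) *\<^sub>R h) n =
      (S n + (1 - f n) *\<^sub>R h, snd (hprod a n) + (\<Sum>j<n. (f j - f (Suc j)) *\<^sub>R B (S j) h + (1 - f j) *\<^sub>R B h (a j)))" for n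
  proof (induction n)
    case 0
    then show ?case using f by (simp add: S zero_prod_def)
  next
    case (Suc n)
    then show ?case
      using fst_hprod[of a n]
      by (simp add: gmult_def S S_def[symmetric] B.add_left B.add_right B.scaleR_left B.scaleR_right
          B.diff_left B.diff_right algebra_simps)
  qed
  have abel: "(\<Sum>j<n. (f j - f (Suc j)) *\<^sub>R S j + f j *\<^sub>R a j) = (\<Sum>j<n. (f j + f (Suc j)) *\<^sub>R a j) - f n *\<^sub>R S n" for n
    by (induction n) (auto simp: S algebra_simps)
  have "(\<Sum>j<M. (f j - f (Suc j)) *\<^sub>R B (S j) h + (1 - f j) *\<^sub>R B h (a j))
      = (\<Sum>j<M. B h (a j)) + (\<Sum>j<M. B ((f j - f (Suc j)) *\<^sub>R S j + f j *\<^sub>R a j) h)"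
    unfolding sum.distrib[symmetric]
  proof (rule sum.cong)
    fix j
    show "(f j - f (Suc j)) *\<^sub>R B (S j) h + (1 - f j) *\<^sub>R B h (a j)
        = B h (a j) + B ((f j - f (Suc j)) *\<^sub>R S j + f j *\<^sub>R a j) h"
      using skew[of h "a j"] by (simp add: B.add_left B.diff_left B.scaleR_left algebra_simps)
  qed simp
  also have "(\<Sum>j<M. B ((f j - f (Suc j)) *\<^sub>R S j + f j *\<^sub>R a j) h) = 0"
    unfolding B.sum_left[symmetric] abel orth f(2) by (simp add: B.zero_left)
  finally show ?thesis
    unfolding gen using f(2) fst_hprod[of a M]
    by (simp add: gmult_def S_def B.sum_right add_ac)
qed

text \<open>Every letter is split into two equal halves, because the orthogonality required of \<open>f\<close> then
  reads \<open>\<Sum> g(k) R\<^sup>k x = 0\<close>. Without the splitting, the condition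
  \<open>\<Sum> (g(k) + g(k+1)) R\<^sup>k x = 0\<close> has no solution when \<open>R x = - x\<close>.\<close>

lemma rotating_word_perturb:
  fixes R :: "real^'m \<Rightarrow> real^'m" and x
  assumes R: "orthogonal_transformation R" and N: "N \<ge> CARD('m) + 1"
  defines "a \<equiv> \<lambda>k. (R ^^ k) x"
  obtains c :: "nat \<Rightarrow> real" where
    "\<And>j. \<bar>c j\<bar> \<le> 3 * (real CARD('m) + 1) * 2 ^ (CARD('m) + 1) / real N"
    "\<And>h. hprod (\<lambda>j. (1/2) *\<^sub>R a (j div 2) + c j *\<^sub>R h) (2 * N) = (h, 0) \<star> hprod a N"
proof -
  define C where "C = 2 * (real CARD('m) + 1) * 2 ^ (CARD('m) + 1) / real N"
  obtain g where g: "g 0 = 1" "\<And>k. k \<ge> N \<Longrightarrow> g k = 0" "\<And>k. \<bar>g (Suc k) - g k\<bar> \<le> C"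
    "(\<Sum>k<N. g k *\<^sub>R a k) = 0"
    using orthogonal_orbit_weights[OF R, of N x] N unfolding a_def C_def by auto
  \<comment> \<open>The odd values are chosen so that
    \<open>f (2k) + 2 * f (2k+1) + f (2k+2) = 4 * g k\<close>, which turns the orthogonality
    condition for the half letters into the one for \<open>g\<close>. The increments of
    \<open>f\<close> are then \<open>1/2\<close> and \<open>3/2\<close> times those of
    \<open>g\<close>.\<close>
  define f where "f j = (if even j then g (j div 2) else (3 * g (j div 2) - g (Suc (j div 2))) / 2)" for j
  have "\<bar>f j - f (Suc j)\<bar> \<le> 3 / 2 * C" for j
  proof (cases "even j")
    case True
    then have "f j - f (Suc j) = (g (Suc (j div 2)) - g (j div 2)) / 2"
      by (simp add: f_def field_simps)
    then show ?thesis using g(3)[of "j div 2"] by (simp add: abs_if split: if_splits)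
  next
    case False
    then have "Suc j div 2 = Suc (j div 2)" by presburger
    then have "f j - f (Suc j) = 3 / 2 * (g (j div 2) - g (Suc (j div 2)))"
      using False by (simp add: f_def field_simps)
    then show ?thesis using g(3)[of "j div 2"] by (simp add: abs_if split: if_splits)
  qed
  moreover have "hprod (\<lambda>j. (1/2) *\<^sub>R a (j div 2) + (f j - f (Suc j)) *\<^sub>R h) (2 * N)
      = (h, 0) \<star> hprod (\<lambda>j. (1/2) *\<^sub>R a (j div 2)) (2 * N)" for h
  proof (rule hprod_perturb)
    show "f 0 = 1" "f (2 * N) = 0" using g by (auto simp: f_def)
    have "(\<Sum>j<2*N. (f j + f (Suc j)) *\<^sub>R (1/2) *\<^sub>R a (j div 2)) = (\<Sum>k<N. 2 *\<^sub>R (g k *\<^sub>R a k))"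
      unfolding sum_pairs
    proof (rule sum.cong)
      fix k
      have "(f (2*k) + f (Suc (2*k))) * (1/2) + (f (2*k+1) + f (Suc (2*k+1))) * (1/2) = 2 * g k"
        by (simp add: f_def field_simps)
      then show "(f (2*k) + f (Suc (2*k))) *\<^sub>R (1/2) *\<^sub>R a (2*k div 2)
          + (f (2*k+1) + f (Suc (2*k+1))) *\<^sub>R (1/2) *\<^sub>R a ((2*k+1) div 2) = 2 *\<^sub>R (g k *\<^sub>R a k)"
        unfolding scaleR_scaleR by (simp add: scaleR_left_distrib[symmetric] del: scaleR_left_distrib)
    qed simp
    also have "\<dots> = 0" unfolding scaleR_sum_right[symmetric] g(4) by simp
    finally show "(\<Sum>j<2*N. (f j + f (Suc j)) *\<^sub>R (1/2) *\<^sub>R a (j div 2)) = 0" .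
  qed
  moreover have "3 / 2 * C = 3 * (real CARD('m) + 1) * 2 ^ (CARD('m) + 1) / real N"
    by (simp add: C_def)
  ultimately show ?thesis
    by (intro that[of "\<lambda>j. f j - f (Suc j)"]) (simp_all only: hprod_double)
qed

end

subsection \<open>The conjugate Hamiltonian\<close>

locale coercive_hamiltonian =
  fixes \<Phi> :: "real \<Rightarrow> real"
  assumes cont: "continuous_on {0..} \<Phi>" and mono: "mono_on {0..} \<Phi>"
    and \<Phi>_0: "\<Phi> 0 = 0"
    and coercive: "filterlim (\<lambda>\<tau>. \<Phi> \<tau> / \<tau>) at_top at_top"
    and strongly_convex: "loc_strongly_convex (\<lambda>s. \<Phi> \<bar>s\<bar>)"
begin

abbreviation \<psi> where "\<psi> \<equiv> conj_star \<Phi>"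

lemma \<Phi>_nonneg: "\<tau> \<ge> 0 \<Longrightarrow> \<Phi> \<tau> \<ge> 0"
  using mono_onD[OF mono, of 0 \<tau>] \<Phi>_0 by simp

text \<open>Beyond \<open>M\<close> coercivity gives
  \<open>\<Phi> \<sigma> \<ge> (R + 1) * \<sigma>\<close>, so
  \<open>r * \<sigma> - \<Phi> \<sigma>\<close> is not positive there, while
  \<open>\<tau> = 0\<close> gives 0. One compact interval thus serves all \<open>r \<le> R\<close>,
  and the supremum defining \<open>\<psi>\<close> is a maximum.\<close>

lemma maximisers_bounded:
  obtains M where "M > 0"
    "\<And>r. 0 \<le> r \<Longrightarrow> r \<le> R \<Longrightarrow> \<exists>\<tau>\<in>{0..M}. \<psi> r = r * \<tau> - \<Phi> \<tau> \<and> (\<forall>\<sigma>\<ge>0. r * \<sigma> - \<Phi> \<sigma> \<le> \<psi> r)"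
proof -
  have "\<forall>\<^sub>F \<tau> in at_top. R + 1 \<le> \<Phi> \<tau> / \<tau>"
    using coercive unfolding filterlim_at_top by blast
  then obtain M0 where M0: "\<And>\<tau>. \<tau> \<ge> M0 \<Longrightarrow> R + 1 \<le> \<Phi> \<tau> / \<tau>"
    unfolding eventually_at_top_linorder by blast
  define M where "M = max M0 1"
  have M: "M > 0" by (simp add: M_def)
  have "\<exists>\<tau>\<in>{0..M}. \<psi> r = r * \<tau> - \<Phi> \<tau> \<and> (\<forall>\<sigma>\<ge>0. r * \<sigma> - \<Phi> \<sigma> \<le> \<psi> r)" if r: "0 \<le> r" "r \<le> R" for r
  proof -
    have "continuous_on {0..M} (\<lambda>\<tau>. r * \<tau> - \<Phi> \<tau>)"
      using continuous_on_subset[OF cont, of "{0..M}"] by (intro continuous_intros) auto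
    then obtain \<tau> where \<tau>: "\<tau> \<in> {0..M}" "\<And>\<sigma>. \<sigma> \<in> {0..M} \<Longrightarrow> r * \<sigma> - \<Phi> \<sigma> \<le> r * \<tau> - \<Phi> \<tau>"
      using continuous_attains_sup[of "{0..M}" "\<lambda>\<tau>. r * \<tau> - \<Phi> \<tau>"] M by auto
    have all: "r * \<sigma> - \<Phi> \<sigma> \<le> r * \<tau> - \<Phi> \<tau>" if "\<sigma> \<ge> 0" for \<sigma>
    proof (cases "\<sigma> \<le> M")
      case True
      then show ?thesis using that \<tau> by auto
    next
      case False
      then have "\<sigma> \<ge> M0" "\<sigma> > 0" by (auto simp: M_def)
      then have "(R + 1) * \<sigma> \<le> \<Phi> \<sigma>" using M0[of \<sigma>] by (simp add: field_simps)
      moreover have "r * \<sigma> \<le> (R + 1) * \<sigma>" using r \<open>\<sigma> > 0\<close> by (intro mult_right_mono) auto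
      moreover have "0 \<le> r * \<tau> - \<Phi> \<tau>" using \<tau>(2)[of 0] M \<Phi>_0 by auto
      ultimately show ?thesis by linarith
    qed
    have "\<psi> r = r * \<tau> - \<Phi> \<tau>"
      unfolding conj_star_def by (rule cSup_eq_maximum) (use \<tau> all in auto)
    then show ?thesis using \<tau>(1) all by auto
  qed
  with M show ?thesis by (rule that)
qed

lemma \<psi>_upper: "0 \<le> r \<Longrightarrow> 0 \<le> \<sigma> \<Longrightarrow> r * \<sigma> - \<Phi> \<sigma> \<le> \<psi> r"
  using maximisers_bounded[of r] by (metis order_refl)

lemma \<psi>_attained: "0 \<le> r \<Longrightarrow> \<exists>\<tau>\<ge>0. \<psi> r = r * \<tau> - \<Phi> \<tau>"
  using maximisers_bounded[of r] by (metis atLeastAtMost_iff order_refl)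

text \<open>The maximiser for \<open>r'\<close> is a slope of \<open>\<psi>\<close> there, and
  \<open>M\<close> bounds these slopes.\<close>

lemma \<psi>_Lipschitz:
  obtains M where "M > 0" "\<And>r r'. 0 \<le> r \<Longrightarrow> r \<le> r' \<Longrightarrow> r' \<le> R \<Longrightarrow> \<psi> r' \<le> \<psi> r + M * (r' - r)"
proof -
  obtain M where M: "M > 0"
    "\<And>r. 0 \<le> r \<Longrightarrow> r \<le> R \<Longrightarrow> \<exists>\<tau>\<in>{0..M}. \<psi> r = r * \<tau> - \<Phi> \<tau> \<and> (\<forall>\<sigma>\<ge>0. r * \<sigma> - \<Phi> \<sigma> \<le> \<psi> r)"
    using maximisers_bounded by blast
  have "\<psi> r' \<le> \<psi> r + M * (r' - r)" if r: "0 \<le> r" "r \<le> r'" "r' \<le> R" for r r'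
  proof -
    obtain \<tau> where \<tau>: "\<tau> \<in> {0..M}" "\<psi> r' = r' * \<tau> - \<Phi> \<tau>" using M(2)[of r'] r by auto
    have "r * \<tau> - \<Phi> \<tau> \<le> \<psi> r" using \<tau> that by (intro \<psi>_upper) auto
    moreover have "\<tau> * (r' - r) \<le> M * (r' - r)" using \<tau> that by (intro mult_right_mono) auto
    ultimately show ?thesis using \<tau>(2) by (simp add: algebra_simps)
  qed
  with M(1) show ?thesis by (rule that)
qed

lemma \<psi>_mono: "0 \<le> r \<Longrightarrow> r \<le> r' \<Longrightarrow> \<psi> r \<le> \<psi> r'"
proof -
  assume r: "0 \<le> r" "r \<le> r'"
  obtain \<tau> where \<tau>: "\<tau> \<ge> 0" "\<psi> r = r * \<tau> - \<Phi> \<tau>" using \<psi>_attained[OF r(1)] by blast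
  have "r * \<tau> \<le> r' * \<tau>" using r \<tau> by (intro mult_right_mono)
  then show ?thesis using \<psi>_upper[of r' \<tau>] r \<tau> by simp
qed

lemma \<psi>_0 [simp]: "\<psi> 0 = 0"
  using \<psi>_attained[of 0] \<psi>_upper[of 0 0] \<Phi>_0 \<Phi>_nonneg by fastforce

lemma \<psi>_nonneg: "0 \<le> r \<Longrightarrow> 0 \<le> \<psi> r"
  using \<psi>_mono[of 0 r] by simp

lemma \<psi>_ge_linear: "0 \<le> r \<Longrightarrow> r - \<Phi> 1 \<le> \<psi> r"
  using \<psi>_upper[of r 1] by simp

lemma \<psi>_convex: "convex_on {0..} \<psi>"
proof (rule convex_onI)
  fix l x y :: real assume l: "0 < l" "l < 1" and xy: "x \<in> {0..}" "y \<in> {0..}"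
  then have "0 \<le> (1 - l) *\<^sub>R x + l *\<^sub>R y" by auto
  then obtain \<tau> where \<tau>: "\<tau> \<ge> 0" "\<psi> ((1 - l) *\<^sub>R x + l *\<^sub>R y) = ((1 - l) *\<^sub>R x + l *\<^sub>R y) * \<tau> - \<Phi> \<tau>"
    using \<psi>_attained by blast
  have "\<dots> = (1 - l) * (x * \<tau> - \<Phi> \<tau>) + l * (y * \<tau> - \<Phi> \<tau>)" by (simp add: algebra_simps)
  also have "\<dots> \<le> (1 - l) * \<psi> x + l * \<psi> y"
    using l xy \<tau>(1) by (intro add_mono mult_left_mono \<psi>_upper) auto
  finally show "\<psi> ((1 - l) *\<^sub>R x + l *\<^sub>R y) \<le> (1 - l) * \<psi> x + l * \<psi> y" using \<tau>(2) by simp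
qed simp

text \<open>Scalar strong convexity compares the two norms with their mean \<open>s\<close> and
  gains \<open>C / 4 * (norm v - norm w)^2\<close>. Passing from \<open>s\<close> down to the norm
  \<open>m\<close> of the midpoint gains \<open>C * (s^2 - m^2)\<close>, and by the parallelogram
  law the two gains add up to \<open>C / 4 * (norm (v - w))^2\<close>.\<close>

lemma \<Phi>_norm_strongly_convex:
  obtains C where "C > 0" "\<And>v w :: 'a::real_inner. norm v \<le> M \<Longrightarrow> norm w \<le> M \<Longrightarrow>
    2 * \<Phi> (norm ((1/2) *\<^sub>R (v + w))) + C / 2 * (norm (v - w))\<^sup>2 \<le> \<Phi> (norm v) + \<Phi> (norm w)"
proof -
  obtain C where C: "C > 0" and H: "\<And>x y l. \<lbrakk>x \<in> {-M..M}; y \<in> {-M..M}; l \<in> {0..1}\<rbrakk> \<Longrightarrow>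
      l * \<Phi> \<bar>x\<bar> + (1 - l) * \<Phi> \<bar>y\<bar> - \<Phi> \<bar>l * x + (1 - l) * y\<bar> \<ge> l * (1 - l) * C * \<bar>x - y\<bar>\<^sup>2"
    using strongly_convex unfolding loc_strongly_convex_def by blast
  \<comment> \<open>\<open>\<Phi>(|s|) - C s\<^sup>2\<close> is even and convex, hence increasing for \<open>s \<ge> 0\<close>\<close>
  have G_mono: "\<Phi> s - C * s\<^sup>2 \<le> \<Phi> r - C * r\<^sup>2" if "0 \<le> s" "s \<le> r" "r \<le> M" for s r
  proof (cases "r = 0")
    case False
    then have "r > 0" using that by simp
    \<comment> \<open>Writes \<open>s\<close> as a convex combination of \<open>r\<close> and
      \<open>-r\<close>, where the even extension takes equal values.\<close>
    define l where "l = (1 + s / r) / 2"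
    have l: "l \<in> {0..1}" using that \<open>r > 0\<close> by (auto simp: l_def field_simps)
    have s: "l * r + (1 - l) * (- r) = s" using \<open>r > 0\<close> by (simp add: l_def field_simps)
    have "l * (1 - l) * C * \<bar>r - (- r)\<bar>\<^sup>2 = C * (r\<^sup>2 - (l * r + (1 - l) * (- r))\<^sup>2)"
      by (simp add: power2_eq_square algebra_simps)
    then show ?thesis
      using H[of r "-r" l] l that unfolding s by (simp add: algebra_simps)
  qed (use that in simp)
  have "2 * \<Phi> (norm ((1/2) *\<^sub>R (v + w))) + C / 2 * (norm (v - w))\<^sup>2 \<le> \<Phi> (norm v) + \<Phi> (norm w)"
    if vw: "norm v \<le> M" "norm w \<le> M" for v w :: 'a
  proof -
    define m where "m = norm ((1/2) *\<^sub>R (v + w))"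
    define s where "s = (norm v + norm w) / 2"
    have ms: "m \<le> s" "0 \<le> m" "s \<le> M"
      using vw norm_triangle_ineq[of v w] by (auto simp: m_def s_def)
    have m2: "m\<^sup>2 = ((norm v)\<^sup>2 + (norm w)\<^sup>2) / 2 - (norm (v - w))\<^sup>2 / 4"
      unfolding m_def power2_norm_eq_inner by (simp add: inner_simps field_simps inner_commute)
    have s_eq: "s = 1/2 * norm v + (1 - 1/2) * norm w" by (simp add: s_def)
    have M: "norm v \<in> {-M..M}" "norm w \<in> {-M..M}"
      using vw norm_ge_zero[of v] norm_ge_zero[of w] unfolding atLeastAtMost_iff by linarith+
    have "s \<ge> 0" by (simp add: s_def)
    have "1/2 * (1 - 1/2) * C * (norm v - norm w)\<^sup>2 \<le> 1/2 * \<Phi> (norm v) + (1 - 1/2) * \<Phi> (norm w) - \<Phi> s"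
      using H[OF M, of "1/2"] \<open>s \<ge> 0\<close> unfolding s_eq[symmetric] by simp
    moreover have "C * s\<^sup>2 = C * ((norm v)\<^sup>2 + (norm w)\<^sup>2) / 2 - C * (norm v - norm w)\<^sup>2 / 4"
      by (simp add: s_def power2_eq_square field_simps)
    moreover have "C * m\<^sup>2 = C * ((norm v)\<^sup>2 + (norm w)\<^sup>2) / 2 - C * (norm (v - w))\<^sup>2 / 4"
      unfolding m2 by (simp add: algebra_simps)
    moreover have "\<Phi> m - C * m\<^sup>2 \<le> \<Phi> s - C * s\<^sup>2" using ms by (intro G_mono) auto
    ultimately show ?thesis unfolding m_def[symmetric] by simp
  qed
  with C show ?thesis by (rule that)
qed

text \<open>Let \<open>x\<close> and \<open>y\<close> be dual maximisers for \<open>v + w\<close>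
  and \<open>v - w\<close>. Their midpoint is tested in \<open>\<psi> (norm v)\<close>; the
  remaining term \<open>w \<bullet> (x - y)\<close> is absorbed by strong convexity, leaving
  \<open>1 / (2 * C) * (norm w)^2\<close>. The bound \<open>R\<close> keeps the maximisers in a ball
  where one \<open>C\<close> is valid.\<close>

lemma \<psi>_norm_semiconcave:
  obtains K where "K > 0" "\<And>v w :: 'a::real_inner. norm (v + w) \<le> R \<Longrightarrow> norm (v - w) \<le> R \<Longrightarrow>
    \<psi> (norm (v + w)) + \<psi> (norm (v - w)) \<le> 2 * \<psi> (norm v) + K * (norm w)\<^sup>2"
proof -
  obtain M where M: "M > 0"
    "\<And>r. 0 \<le> r \<Longrightarrow> r \<le> R \<Longrightarrow> \<exists>\<tau>\<in>{0..M}. \<psi> r = r * \<tau> - \<Phi> \<tau> \<and> (\<forall>\<sigma>\<ge>0. r * \<sigma> - \<Phi> \<sigma> \<le> \<psi> r)"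
    using maximisers_bounded by blast
  obtain C where C: "C > 0" "\<And>v w :: 'a. norm v \<le> M \<Longrightarrow> norm w \<le> M \<Longrightarrow>
    2 * \<Phi> (norm ((1/2) *\<^sub>R (v + w))) + C / 2 * (norm (v - w))\<^sup>2 \<le> \<Phi> (norm v) + \<Phi> (norm w)"
    using \<Phi>_norm_strongly_convex[where ?'a = 'a] by blast
  have dual: "\<exists>x. norm x \<le> M \<and> \<psi> (norm v) \<le> v \<bullet> x - \<Phi> (norm x)" if v: "norm v \<le> R" for v :: 'a
  proof -
    obtain \<tau> where \<tau>: "\<tau> \<in> {0..M}" "\<psi> (norm v) = norm v * \<tau> - \<Phi> \<tau>" using M(2)[of "norm v"] v by auto
    \<comment> \<open>For \<open>v = 0\<close> the vector degenerates to 0; then only monotonicity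
      of \<open>\<Phi>\<close> is needed.\<close>
    have "v \<bullet> (\<tau> *\<^sub>R sgn v) = norm v * \<tau>"
      by (cases "v = 0") (auto simp: sgn_div_norm dot_square_norm power2_eq_square)
    moreover have n: "norm (\<tau> *\<^sub>R sgn v) \<le> \<tau>" using \<tau> by (simp add: norm_sgn)
    moreover have "\<Phi> (norm (\<tau> *\<^sub>R sgn v)) \<le> \<Phi> \<tau>" using n \<tau> by (intro mono_onD[OF mono]) auto
    ultimately show ?thesis using \<tau> by (intro exI[of _ "\<tau> *\<^sub>R sgn v"]) auto
  qed
  have "\<psi> (norm (v + w)) + \<psi> (norm (v - w)) \<le> 2 * \<psi> (norm v) + 1 / (2 * C) * (norm w)\<^sup>2"
    if vw: "norm (v + w) \<le> R" "norm (v - w) \<le> R" for v w :: 'a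
  proof -
    obtain x where x: "norm x \<le> M" "\<psi> (norm (v + w)) \<le> (v + w) \<bullet> x - \<Phi> (norm x)" using dual[OF vw(1)] by blast
    obtain y where y: "norm y \<le> M" "\<psi> (norm (v - w)) \<le> (v - w) \<bullet> y - \<Phi> (norm y)" using dual[OF vw(2)] by blast
    define m where "m = (1/2) *\<^sub>R (x + y)"
    have "v \<bullet> m \<le> norm v * norm m" by (rule norm_cauchy_schwarz)
    moreover have "norm v * norm m - \<Phi> (norm m) \<le> \<psi> (norm v)" by (intro \<psi>_upper) auto
    moreover have "w \<bullet> (x - y) \<le> norm w * norm (x - y)" by (rule norm_cauchy_schwarz)
    moreover have "norm w * norm (x - y) \<le> C / 2 * (norm (x - y))\<^sup>2 + 1 / (2 * C) * (norm w)\<^sup>2"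
    proof -
      have "0 \<le> (C * norm (x - y) - norm w)\<^sup>2 / (2 * C)" using C by simp
      also have "\<dots> = C / 2 * (norm (x - y))\<^sup>2 + 1 / (2 * C) * (norm w)\<^sup>2 - norm w * norm (x - y)"
        using C by (simp add: power2_eq_square field_simps)
      finally show ?thesis by simp
    qed
    moreover have "2 * \<Phi> (norm m) + C / 2 * (norm (x - y))\<^sup>2 \<le> \<Phi> (norm x) + \<Phi> (norm y)"
      unfolding m_def by (rule C(2)[OF x(1) y(1)])
    moreover have "(v + w) \<bullet> x + (v - w) \<bullet> y = 2 * (v \<bullet> m) + w \<bullet> (x - y)"
      by (simp add: m_def inner_simps algebra_simps)
    ultimately show ?thesis using x(2) y(2) by linarith
  qed
  then show ?thesis using C(1) by (intro that[of "1 / (2 * C)"]) auto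
qed

end

subsection \<open>Semiconcavity of the Hopf-Lax function\<close>

locale step2_hopf_lax = step2_group B + coercive_hamiltonian \<Phi>
  for B :: "real^'m \<Rightarrow> real^'m \<Rightarrow> real^'k" and \<Phi> :: "real \<Rightarrow> real" +
  fixes t :: real
  assumes t: "t > 0"
begin

text \<open>Rotating words with endpoint near \<open>w\<close> are perturbed by \<open>h\<close> and
  \<open>-h\<close> with the same weights, and \<open>\<psi>_norm_semiconcave\<close> is applied to
  each letter. All constants are chosen before \<open>w\<close>, \<open>h\<close> and the word
  length.\<close>

lemma cc_dist_horizontal_semiconcave:
  assumes D: "D \<ge> 0"
  obtains K where "K \<ge> 0" "\<And>w h. \<lbrakk>dist_cc 0 w \<le> D; norm h \<le> 1\<rbrakk> \<Longrightarrow>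
    \<psi> (dist_cc 0 ((h, 0) \<star> w) / t) + \<psi> (dist_cc 0 ((- h, 0) \<star> w) / t)
      \<le> 2 * \<psi> (dist_cc 0 w / t) + K * (norm h)\<^sup>2"
proof -
  \<comment> \<open>Twice the constant of \<open>rotating_word_perturb\<close>, because a word of
    \<open>2 * N\<close> letters is rescaled by \<open>2 * N\<close>.\<close>
  define C where "C = 6 * (real CARD('m) + 1) * 2 ^ (CARD('m) + 1)"
  have C: "C \<ge> 0" by (simp add: C_def)
  obtain K where K: "K > 0" "\<And>v w :: real^'m. norm (v + w) \<le> (D + 1 + C) / t \<Longrightarrow> norm (v - w) \<le> (D + 1 + C) / t \<Longrightarrow>
    \<psi> (norm (v + w)) + \<psi> (norm (v - w)) \<le> 2 * \<psi> (norm v) + K * (norm w)\<^sup>2"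
    using \<psi>_norm_semiconcave[where ?'a = "real^'m"] by blast
  obtain M where M: "M > 0" "\<And>r r'. 0 \<le> r \<Longrightarrow> r \<le> r' \<Longrightarrow> r' \<le> (D + 2 + C) / t \<Longrightarrow> \<psi> r' \<le> \<psi> r + M * (r' - r)"
    using \<psi>_Lipschitz by blast
  define K' where "K' = K * (C / t)\<^sup>2"
  have "\<psi> (dist_cc 0 ((h, 0) \<star> w) / t) + \<psi> (dist_cc 0 ((- h, 0) \<star> w) / t)
      \<le> 2 * \<psi> (dist_cc 0 w / t) + K' * (norm h)\<^sup>2"
    if w: "dist_cc 0 w \<le> D" and h: "norm h \<le> 1" for w h
  proof (rule field_le_epsilon)
    fix \<epsilon> :: real assume \<epsilon>: "\<epsilon> > 0"
    \<comment> \<open>Four errors of size \<open>M * \<eta> / t\<close> arise: one endpoint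
      correction for each sign of \<open>h\<close>, and two from the excess length of the
      unperturbed word.\<close>
    define \<eta> where "\<eta> = min 1 (\<epsilon> * t / (4 * M))"
    have \<eta>: "\<eta> > 0" "\<eta> \<le> 1" "4 * (M * (\<eta> / t)) \<le> \<epsilon>"
    proof -
      show "\<eta> > 0" "\<eta> \<le> 1" using \<epsilon> t M(1) by (auto simp: \<eta>_def)
      have "\<eta> \<le> \<epsilon> * t / (4 * M)" by (simp add: \<eta>_def)
      then show "4 * (M * (\<eta> / t)) \<le> \<epsilon>" using t M(1) by (simp add: field_simps)
    qed
    \<comment> \<open>Words reach only a Euclidean neighbour \<open>w'\<close> of \<open>w\<close>;
      its distance to \<open>w\<close> is below \<open>\<eta>\<close>, and left translation by
      \<open>h\<close> or \<open>-h\<close> does not change it.\<close>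
    have "((\<lambda>w'. dist_cc w' w) \<longlongrightarrow> 0) (at w)"
      by (rule cc_dist_tendsto_0) auto
    then have "\<forall>\<^sub>F w' in at w. dist_cc w' w < \<eta>"
      using \<eta>(1) by (rule order_tendstoD)
    then obtain e where e: "e > 0" "\<And>w'. w' \<noteq> w \<Longrightarrow> dist w' w < e \<Longrightarrow> dist_cc w' w < \<eta>"
      unfolding eventually_at by auto
    have e': "dist_cc w' w < \<eta>" if "norm (w' - w) < e" for w'
      using e(2)[of w'] that \<eta>(1) by (cases "w' = w") (auto simp: dist_norm)
    have "\<forall>\<^sub>F N in sequentially. \<exists>(R :: real^'m \<Rightarrow> real^'m) x. orthogonal_transformation R
        \<and> norm (hprod (\<lambda>k. (R ^^ k) x) N - w) < e \<and> norm x \<le> (dist_cc 0 w + \<eta>) / real N"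
      using \<eta> e by (intro near_optimal_rotating_word) auto
    moreover have "\<forall>\<^sub>F N in sequentially. N \<ge> CARD('m) + 1" by (rule eventually_ge_at_top)
    ultimately have "\<forall>\<^sub>F N in sequentially. N \<ge> CARD('m) + 1 \<and> (\<exists>(R :: real^'m \<Rightarrow> real^'m) x. orthogonal_transformation R
        \<and> norm (hprod (\<lambda>k. (R ^^ k) x) N - w) < e \<and> norm x \<le> (dist_cc 0 w + \<eta>) / real N)"
      by eventually_elim blast
    from eventually_happens'[OF sequentially_bot this]
    obtain N and R :: "real^'m \<Rightarrow> real^'m" and x where N: "N \<ge> CARD('m) + 1" and R: "orthogonal_transformation R"
      and wN: "norm (hprod (\<lambda>k. (R ^^ k) x) N - w) < e" and x: "norm x \<le> (dist_cc 0 w + \<eta>) / real N"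
      by blast
    have N0: "real N > 0" using N by simp
    define a where "a k = (R ^^ k) x" for k
    define w' where "w' = hprod a N"
    have w': "dist_cc w' w < \<eta>" unfolding w'_def a_def[abs_def] by (rule e'[OF wN])
    obtain c where c: "\<And>j. \<bar>c j\<bar> \<le> 3 * (real CARD('m) + 1) * 2 ^ (CARD('m) + 1) / real N"
      "\<And>h. hprod (\<lambda>j. (1/2) *\<^sub>R a (j div 2) + c j *\<^sub>R h) (2 * N) = (h, 0) \<star> w'"
      using rotating_word_perturb[OF R N, of x] unfolding w'_def a_def[abs_def] by blast
    have na: "norm (a k) = norm x" for k
      unfolding a_def by (induction k) (simp_all add: orthogonal_transformation_norm[OF R])
    \<comment> \<open>Scaled so that the letter \<open>j\<close> of the word perturbed by
      \<open>s h\<close> is \<open>t / (2 * N)\<close> times \<open>U j + s V j\<close>; its length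
      divided by \<open>t\<close> is then an average of these norms, ready for Jensen.\<close>
    define U where "U j = (real N / t) *\<^sub>R a (j div 2)" for j
    define V where "V j = (2 * real N * c j / t) *\<^sub>R h" for j
    have nU: "norm (U j) = real N * norm x / t" for j
      using t by (simp add: U_def na)
    have U_le: "real N * norm x / t \<le> (dist_cc 0 w + \<eta>) / t"
      using x N0 t by (intro divide_right_mono) (auto simp: field_simps)
    have nV: "norm (V j) \<le> C / t * norm h" for j
    proof -
      have "2 * real N * \<bar>c j\<bar> \<le> C" using c(1)[of j] N0 by (simp add: C_def field_simps)
      then have "2 * real N * \<bar>c j\<bar> / t \<le> C / t" using t by (intro divide_right_mono) auto
      then have "2 * real N * \<bar>c j\<bar> / t * norm h \<le> C / t * norm h" by (intro mult_right_mono) auto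
      then show ?thesis using t by (simp add: V_def abs_mult)
    qed
    have nV1: "norm (V j) \<le> C / t" for j
      using nV[of j] h C t mult_left_le[of "norm h" "C / t"] by simp
    have UV: "norm (U j + s *\<^sub>R V j) \<le> (D + 1 + C) / t" if "\<bar>s\<bar> = 1" for s j
    proof -
      have "norm (U j + s *\<^sub>R V j) \<le> norm (U j) + norm (s *\<^sub>R V j)" by (rule norm_triangle_ineq)
      also have "\<dots> \<le> (dist_cc 0 w + \<eta>) / t + C / t"
        using nU[of j] nV1[of j] U_le that by simp
      also have "\<dots> \<le> (D + 1) / t + C / t"
        using w \<eta>(2) t by (intro add_right_mono divide_right_mono) auto
      finally show ?thesis by (simp add: add_divide_distrib)
    qed
    have one: "\<psi> (dist_cc 0 ((s *\<^sub>R h, 0) \<star> w) / t)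
        \<le> (\<Sum>j<2*N. 1 / (2 * real N) * \<psi> (norm (U j + s *\<^sub>R V j))) + M * (\<eta> / t)"
      if s: "\<bar>s\<bar> = 1" for s
    proof -
      define d where "d = dist_cc 0 ((s *\<^sub>R h, 0) \<star> w')"
      define y where "y = (\<Sum>j<2*N. (1 / (2 * real N)) *\<^sub>R norm (U j + s *\<^sub>R V j))"
      have sum1: "(\<Sum>j<2*N. 1 / (2 * real N)) = 1" using N0 by simp
      have "d \<le> (\<Sum>j<2*N. norm ((1/2) *\<^sub>R a (j div 2) + c j *\<^sub>R (s *\<^sub>R h)))"
        unfolding d_def c(2)[symmetric] by (rule cc_dist_le[OF reach_hprod])
      also have "\<dots> = t * y"
        unfolding y_def sum_distrib_left
      proof (rule sum.cong[OF refl])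
        fix j
        have "(1/2) *\<^sub>R a (j div 2) + c j *\<^sub>R (s *\<^sub>R h) = (t / (2 * real N)) *\<^sub>R (U j + s *\<^sub>R V j)"
          using t N0 by (simp add: U_def V_def scaleR_add_right mult_ac)
        then have "norm ((1/2) *\<^sub>R a (j div 2) + c j *\<^sub>R (s *\<^sub>R h)) = t / (2 * real N) * norm (U j + s *\<^sub>R V j)"
          using t by simp
        then show "norm ((1/2) *\<^sub>R a (j div 2) + c j *\<^sub>R (s *\<^sub>R h)) = t * ((1 / (2 * real N)) *\<^sub>R norm (U j + s *\<^sub>R V j))"
          by simp
      qed
      finally have dy: "d / t \<le> y" using t by (simp add: field_simps)
      have d0: "0 \<le> d / t" using t cc_dist_nonneg by (simp add: d_def)
      have "y \<le> (\<Sum>j<2*N. (1 / (2 * real N)) *\<^sub>R ((D + 1 + C) / t))"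
        unfolding y_def using UV[OF s] by (intro sum_mono scaleR_left_mono) auto
      also have "\<dots> = (D + 1 + C) / t" using N0 by simp
      finally have yb: "y \<le> (D + 1 + C) / t" .
      have "dist_cc 0 ((s *\<^sub>R h, 0) \<star> w) \<le> d + dist_cc ((s *\<^sub>R h, 0) \<star> w') ((s *\<^sub>R h, 0) \<star> w)"
        unfolding d_def by (rule cc_dist_triangle)
      also have "\<dots> \<le> d + \<eta>" using w' by (simp add: cc_dist_translate)
      finally have "dist_cc 0 ((s *\<^sub>R h, 0) \<star> w) / t \<le> d / t + \<eta> / t"
        using t by (simp add: divide_right_mono flip: add_divide_distrib)
      then have "\<psi> (dist_cc 0 ((s *\<^sub>R h, 0) \<star> w) / t) \<le> \<psi> (d / t + \<eta> / t)"
        using t cc_dist_nonneg by (intro \<psi>_mono) auto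
      also have "\<dots> \<le> \<psi> (d / t) + M * (d / t + \<eta> / t - d / t)"
      proof (rule M(2)[OF d0])
        show "d / t \<le> d / t + \<eta> / t" using \<eta> t by simp
        have "\<eta> / t \<le> 1 / t" using \<eta> t by (intro divide_right_mono) auto
        then have "d / t + \<eta> / t \<le> (D + 1 + C) / t + 1 / t" using dy yb by linarith
        then show "d / t + \<eta> / t \<le> (D + 2 + C) / t" by (simp add: add_divide_distrib)
      qed
      also have "\<psi> (d / t) \<le> \<psi> y" using d0 dy by (rule \<psi>_mono)
      also have "\<psi> y \<le> (\<Sum>j<2*N. 1 / (2 * real N) * \<psi> (norm (U j + s *\<^sub>R V j)))"
        unfolding y_def using N0 sum1
        by (intro convex_on_sum[OF _ _ \<psi>_convex]) (auto simp: lessThan_empty_iff)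
      finally show ?thesis by simp
    qed
    have "(\<Sum>j<2*N. 1 / (2 * real N) * \<psi> (norm (U j + 1 *\<^sub>R V j))) + (\<Sum>j<2*N. 1 / (2 * real N) * \<psi> (norm (U j + (-1) *\<^sub>R V j)))
      = (\<Sum>j<2*N. 1 / (2 * real N) * (\<psi> (norm (U j + V j)) + \<psi> (norm (U j - V j))))"
      unfolding sum.distrib[symmetric] by (intro sum.cong) (auto simp: algebra_simps)
    also have "\<dots> \<le> (\<Sum>j<2*N. 1 / (2 * real N) * (2 * \<psi> ((dist_cc 0 w + \<eta>) / t) + K' * (norm h)\<^sup>2))"
    proof (intro sum_mono mult_left_mono)
      fix j
      have "\<psi> (norm (U j + V j)) + \<psi> (norm (U j - V j)) \<le> 2 * \<psi> (norm (U j)) + K * (norm (V j))\<^sup>2"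
        using UV[of 1 j] UV[of "-1" j] by (intro K(2)) auto
      moreover have "\<psi> (norm (U j)) \<le> \<psi> ((dist_cc 0 w + \<eta>) / t)"
        using U_le by (intro \<psi>_mono norm_ge_zero) (simp only: nU)
      moreover have "K * (norm (V j))\<^sup>2 \<le> K' * (norm h)\<^sup>2"
      proof -
        have "(norm (V j))\<^sup>2 \<le> (C / t * norm h)\<^sup>2" using nV by (intro power_mono) auto
        then have "K * (norm (V j))\<^sup>2 \<le> K * (C / t * norm h)\<^sup>2" using K(1) by (intro mult_left_mono) auto
        then show ?thesis unfolding K'_def by (simp only: power_mult_distrib mult.assoc)
      qed
      ultimately show "\<psi> (norm (U j + V j)) + \<psi> (norm (U j - V j))
          \<le> 2 * \<psi> ((dist_cc 0 w + \<eta>) / t) + K' * (norm h)\<^sup>2" by linarith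
    qed simp
    also have "\<dots> = 2 * \<psi> ((dist_cc 0 w + \<eta>) / t) + K' * (norm h)\<^sup>2"
      using N0 by simp
    finally have sums: "(\<Sum>j<2*N. 1 / (2 * real N) * \<psi> (norm (U j + 1 *\<^sub>R V j))) + (\<Sum>j<2*N. 1 / (2 * real N) * \<psi> (norm (U j + (-1) *\<^sub>R V j)))
      \<le> 2 * \<psi> ((dist_cc 0 w + \<eta>) / t) + K' * (norm h)\<^sup>2" .
    have "\<psi> ((dist_cc 0 w + \<eta>) / t) \<le> \<psi> (dist_cc 0 w / t) + M * ((dist_cc 0 w + \<eta>) / t - dist_cc 0 w / t)"
    proof (rule M(2))
      show "0 \<le> dist_cc 0 w / t" using t cc_dist_nonneg by simp
      show "dist_cc 0 w / t \<le> (dist_cc 0 w + \<eta>) / t" using t \<eta> by (intro divide_right_mono) auto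
      show "(dist_cc 0 w + \<eta>) / t \<le> (D + 2 + C) / t" using t \<eta> w C by (intro divide_right_mono) auto
    qed
    also have "(dist_cc 0 w + \<eta>) / t - dist_cc 0 w / t = \<eta> / t" by (simp add: add_divide_distrib)
    finally have "\<psi> ((dist_cc 0 w + \<eta>) / t) \<le> \<psi> (dist_cc 0 w / t) + M * (\<eta> / t)" .
    with sums one[of 1] one[of "-1"] \<eta>(3)
    show "\<psi> (dist_cc 0 ((h, 0) \<star> w) / t) + \<psi> (dist_cc 0 ((- h, 0) \<star> w) / t)
      \<le> 2 * \<psi> (dist_cc 0 w / t) + K' * (norm h)\<^sup>2 + \<epsilon>" by simp
  qed
  moreover have "K' \<ge> 0" using K(1) by (simp add: K'_def)
  ultimately show ?thesis by (rule that[rotated])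
qed

section \<open>Bounds and regularity of the Hopf-Lax function\<close>

lemma uminus_gm: "- (p \<star> q) = (- q) \<star> (- p)"
  using skew[of "fst p" "fst q"] by (simp add: gmult_def B.minus_left B.minus_right)

lemma hopf_lax_bounds:
  assumes G: "\<forall>q. \<bar>g q\<bar> \<le> G"
  shows "hopf_lax B \<Phi> g t p \<le> g q + t * \<psi> (dist_cc p q / t)" "\<bar>hopf_lax B \<Phi> g t p\<bar> \<le> G"
proof -
  have lower: "- G \<le> g q + t * \<psi> (dist_cc p q / t)" for q
  proof -
    have "0 \<le> t * \<psi> (dist_cc p q / t)"
      using t cc_dist_nonneg[of p q] by (intro mult_nonneg_nonneg \<psi>_nonneg) auto
    then show ?thesis using spec[OF G, of q] by linarith
  qed
  then have "bdd_below (range (\<lambda>q. g q + t * \<psi> (dist_cc p q / t)))"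
    by (intro bdd_belowI[of _ "- G"]) auto
  then show le: "hopf_lax B \<Phi> g t p \<le> g q + t * \<psi> (dist_cc p q / t)" for q
    unfolding hopf_lax_def by (intro cINF_lower) auto
  have "- G \<le> hopf_lax B \<Phi> g t p"
    unfolding hopf_lax_def using lower by (intro cINF_greatest) auto
  moreover have "hopf_lax B \<Phi> g t p \<le> G" using le[of p] spec[OF G, of p] by simp
  ultimately show "\<bar>hopf_lax B \<Phi> g t p\<bar> \<le> G" by linarith
qed

text \<open>Since \<open>\<psi> r \<ge> r - \<Phi> 1\<close>, a distant \<open>q\<close> costs at
  least \<open>dist_cc p q - t * \<Phi> 1 - G\<close>, while the infimum is at most
  \<open>G\<close>. The radius does not depend on \<open>p\<close>.\<close>

lemma hopf_lax_near_minimiser: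
  assumes G: "\<forall>q. \<bar>g q\<bar> \<le> G" and e: "e > 0" "e \<le> 1"
  obtains q where "g q + t * \<psi> (dist_cc p q / t) \<le> hopf_lax B \<Phi> g t p + e"
    "dist_cc p q \<le> 2 * G + 1 + t * \<Phi> 1"
proof -
  define S where "S = range (\<lambda>q. g q + t * \<psi> (dist_cc p q / t))"
  have "S \<noteq> {}" "Inf S < hopf_lax B \<Phi> g t p + e"
    using e by (simp_all add: hopf_lax_def S_def)
  from cInf_lessD[OF this] obtain q where q: "g q + t * \<psi> (dist_cc p q / t) < hopf_lax B \<Phi> g t p + e"
    unfolding S_def by blast
  have "dist_cc p q / t - \<Phi> 1 \<le> \<psi> (dist_cc p q / t)"
    using t cc_dist_nonneg by (intro \<psi>_ge_linear) auto
  then have "t * (dist_cc p q / t - \<Phi> 1) \<le> t * \<psi> (dist_cc p q / t)"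
    using t by (intro mult_left_mono) auto
  then have "dist_cc p q - t * \<Phi> 1 \<le> t * \<psi> (dist_cc p q / t)"
    using t by (simp add: right_diff_distrib)
  then have "dist_cc p q \<le> 2 * G + 1 + t * \<Phi> 1"
    using q e hopf_lax_bounds(2)[OF G, of p] spec[OF G, of q] by linarith
  with q show ?thesis by (intro that[of q]) auto
qed

text \<open>A near-minimiser for \<open>p'\<close> close to \<open>p\<close> is a competitor at
  \<open>p\<close>. It lies within a fixed distance of \<open>p'\<close>, so a single Lipschitz
  constant of \<open>\<psi>\<close> bounds the change of cost for all such
  \<open>p'\<close>.\<close>

lemma lsc_hopf_lax:
  assumes G: "\<forall>q. \<bar>g q\<bar> \<le> G"
  shows "lsc (hopf_lax B \<Phi> g t)"
  unfolding lsc_def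
proof (rule allI, subst open_subopen, rule ballI)
  fix a p
  assume "p \<in> {p. a < hopf_lax B \<Phi> g t p}"
  then have ap: "a < hopf_lax B \<Phi> g t p" by simp
  define D where "D = 2 * G + 1 + t * \<Phi> 1"
  obtain M where M: "M > 0" "\<And>r r'. 0 \<le> r \<Longrightarrow> r \<le> r' \<Longrightarrow> r' \<le> (D + 1) / t \<Longrightarrow> \<psi> r' \<le> \<psi> r + M * (r' - r)"
    using \<psi>_Lipschitz by blast
  \<comment> \<open>One \<open>e\<close> is lost to near-minimality and one to the change of base
    point; the third makes the inequality strict.\<close>
  define e where "e = min 1 ((hopf_lax B \<Phi> g t p - a) / 3)"
  have e: "e > 0" "e \<le> 1" "3 * e \<le> hopf_lax B \<Phi> g t p - a" using ap by (auto simp: e_def min_def)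
  define \<delta> where "\<delta> = min 1 (e / M)"
  have \<delta>: "\<delta> > 0" "\<delta> \<le> 1" "M * \<delta> \<le> e"
  proof -
    show "\<delta> > 0" "\<delta> \<le> 1" using e M by (auto simp: \<delta>_def)
    have "\<delta> \<le> e / M" by (simp add: \<delta>_def)
    then show "M * \<delta> \<le> e" using M(1) by (simp add: field_simps)
  qed
  have "((\<lambda>p'. dist_cc p p') \<longlongrightarrow> 0) (nhds p)"
    by (rule cc_dist_tendsto_0) (auto simp: filterlim_ident)
  then have "\<forall>\<^sub>F p' in nhds p. dist_cc p p' < \<delta>" using \<delta>(1) by (rule order_tendstoD)
  then obtain T where T: "open T" "p \<in> T" "\<And>p'. p' \<in> T \<Longrightarrow> dist_cc p p' < \<delta>"
    unfolding eventually_nhds by auto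
  have "a < hopf_lax B \<Phi> g t p'" if p': "p' \<in> T" for p'
  proof -
    obtain q where q: "g q + t * \<psi> (dist_cc p' q / t) \<le> hopf_lax B \<Phi> g t p' + e" "dist_cc p' q \<le> D"
      using hopf_lax_near_minimiser[OF G e(1,2), of p'] unfolding D_def by blast
    have "dist_cc p q \<le> dist_cc p' q + \<delta>"
      using cc_dist_triangle[of p q p'] T(3)[OF p'] by linarith
    then have "\<psi> (dist_cc p q / t) \<le> \<psi> ((dist_cc p' q + \<delta>) / t)"
      using t cc_dist_nonneg[of p q] by (intro \<psi>_mono divide_right_mono) auto
    also have "\<dots> \<le> \<psi> (dist_cc p' q / t) + M * ((dist_cc p' q + \<delta>) / t - dist_cc p' q / t)"
      using t \<delta> q(2) cc_dist_nonneg[of p' q] by (intro M(2) divide_right_mono) auto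
    also have "(dist_cc p' q + \<delta>) / t - dist_cc p' q / t = \<delta> / t" by (simp add: add_divide_distrib)
    finally have "t * \<psi> (dist_cc p q / t) \<le> t * (\<psi> (dist_cc p' q / t) + M * (\<delta> / t))"
      using t by (intro mult_left_mono) auto
    also have "\<dots> = t * \<psi> (dist_cc p' q / t) + M * \<delta>" using t by (simp add: field_simps)
    finally show ?thesis
      using hopf_lax_bounds(1)[OF G, of p q] q(1) \<delta>(3) e by linarith
  qed
  then show "\<exists>T. open T \<and> p \<in> T \<and> T \<subseteq> {p. a < hopf_lax B \<Phi> g t p}"
    using T(1,2) by blast
qed

text \<open>For \<open>norm h \<le> 1\<close>, one near-minimiser \<open>q\<close> at
  \<open>p\<close> is used as competitor at both shifted points, so \<open>g q\<close> cancels in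
  the second difference.\<close>

lemma h_semiconcave_hopf_lax:
  assumes G: "\<forall>q. \<bar>g q\<bar> \<le> G"
  shows "h_semiconcave B (hopf_lax B \<Phi> g t)"
proof -
  let ?u = "hopf_lax B \<Phi> g t"
  define D where "D = 2 * G + 1 + t * \<Phi> 1"
  have G0: "G \<ge> 0" using spec[OF G, of 0] by linarith
  then have D0: "D \<ge> 0" using t \<Phi>_nonneg[of 1] by (simp add: D_def)
  obtain K where K: "K \<ge> 0" "\<And>w h. \<lbrakk>dist_cc 0 w \<le> D; norm h \<le> 1\<rbrakk> \<Longrightarrow>
    \<psi> (dist_cc 0 ((h, 0) \<star> w) / t) + \<psi> (dist_cc 0 ((- h, 0) \<star> w) / t)
      \<le> 2 * \<psi> (dist_cc 0 w / t) + K * (norm h)\<^sup>2"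
    using cc_dist_horizontal_semiconcave[OF D0] by blast
  have "?u (p \<star> (h, 0)) + ?u (p \<star> (- (h, 0))) - 2 * ?u p \<le> (t * K + 4 * G) * (norm h)\<^sup>2" for p h
  proof (cases "norm h \<le> 1")
    case True
    have "?u (p \<star> (h, 0)) + ?u (p \<star> (- (h, 0))) \<le> 2 * ?u p + t * K * (norm h)\<^sup>2"
    proof (rule field_le_epsilon)
      fix \<epsilon> :: real assume "\<epsilon> > 0"
      define e where "e = min 1 (\<epsilon> / 2)"
      have e: "e > 0" "e \<le> 1" "2 * e \<le> \<epsilon>" using \<open>\<epsilon> > 0\<close> by (auto simp: e_def)
      obtain q where q: "g q + t * \<psi> (dist_cc p q / t) \<le> ?u p + e" "dist_cc p q \<le> D"
        using hopf_lax_near_minimiser[OF G e(1,2), of p] unfolding D_def by blast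
      define w where "w = (- p) \<star> q"
      have pq: "dist_cc p q = dist_cc 0 w" unfolding w_def by (rule cc_dist_eq)
      \<comment> \<open>Right multiplication of \<open>p\<close> by \<open>(v, 0)\<close> becomes
        left multiplication of \<open>w\<close> by its inverse, which is the form of perturbation
        that words allow.\<close>
      have shift: "dist_cc (p \<star> (v, 0)) q = dist_cc 0 ((- v, 0) \<star> w)" for v
        unfolding w_def cc_dist_eq[of "p \<star> (v, 0)"] uminus_gm gm_assoc by simp
      have "\<psi> (dist_cc 0 ((h, 0) \<star> w) / t) + \<psi> (dist_cc 0 ((- h, 0) \<star> w) / t)
          \<le> 2 * \<psi> (dist_cc 0 w / t) + K * (norm h)\<^sup>2"
        using q(2) True unfolding pq by (intro K)
      then have "t * (\<psi> (dist_cc 0 ((h, 0) \<star> w) / t) + \<psi> (dist_cc 0 ((- h, 0) \<star> w) / t))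
          \<le> t * (2 * \<psi> (dist_cc 0 w / t) + K * (norm h)\<^sup>2)"
        using t by (intro mult_left_mono) auto
      moreover have "?u (p \<star> (h, 0)) \<le> g q + t * \<psi> (dist_cc 0 ((- h, 0) \<star> w) / t)"
        using hopf_lax_bounds(1)[OF G, of "p \<star> (h, 0)" q] unfolding shift .
      moreover have "?u (p \<star> (- h, 0)) \<le> g q + t * \<psi> (dist_cc 0 ((h, 0) \<star> w) / t)"
        using hopf_lax_bounds(1)[OF G, of "p \<star> (- h, 0)" q] unfolding shift by simp
      ultimately show "?u (p \<star> (h, 0)) + ?u (p \<star> (- (h, 0))) \<le> 2 * ?u p + t * K * (norm h)\<^sup>2 + \<epsilon>"
        using q(1) e(3) unfolding pq by (simp add: algebra_simps)
    qed
    moreover have "0 \<le> 4 * G * (norm h)\<^sup>2" using G0 by simp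
    ultimately show ?thesis by (simp add: algebra_simps)
  next
    case False
    \<comment> \<open>For large \<open>h\<close> the second difference is at most
      \<open>4 * G\<close> by boundedness alone.\<close>
    then have "1 \<le> (norm h)\<^sup>2" by (simp add: one_le_power)
    then have "4 * G * 1 \<le> 4 * G * (norm h)\<^sup>2" using G0 by (intro mult_left_mono) auto
    moreover have "0 \<le> t * K * (norm h)\<^sup>2" using t K by simp
    moreover have "?u (p \<star> (h, 0)) \<le> G" "?u (p \<star> (- (h, 0))) \<le> G" "- G \<le> ?u p"
      using hopf_lax_bounds(2)[OF G, of "p \<star> (h, 0)"] hopf_lax_bounds(2)[OF G, of "p \<star> (- (h, 0))"]
        hopf_lax_bounds(2)[OF G, of p] by linarith+
    ultimately show ?thesis by (simp add: algebra_simps)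
  qed
  then show ?thesis
    unfolding h_semiconcave_def using lsc_hopf_lax[OF G] t K(1) G0
    by (intro conjI exI[of _ "t * K + 4 * G"]) auto
qed

end

theorem theorem6p4:
  fixes B :: "real^'m \<Rightarrow> real^'m \<Rightarrow> real^'k"
    and g :: "(real^'m) \<times> (real^'k) \<Rightarrow> real"
    and \<Phi> :: "real \<Rightarrow> real"
  assumes "carnot2 B"
    and "bounded (range g)" and "lsc g"
    and "continuous_on {0..} \<Phi>" and "convex_on {0..} \<Phi>" and "mono_on {0..} \<Phi>"
    and "\<forall>\<tau>\<ge>0. \<Phi> \<tau> \<ge> 0" and "\<Phi> 0 = 0"
    and "filterlim (\<lambda>\<tau>. \<Phi> \<tau> / \<tau>) at_top at_top"
    and "loc_strongly_convex (\<lambda>s. \<Phi> \<bar>s\<bar>)"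
    and "t > 0"
  shows "h_semiconcave B (hopf_lax B \<Phi> g t)"
proof -
  interpret step2_hopf_lax B \<Phi> t
    by unfold_locales fact+
  obtain G where "\<forall>q. \<bar>g q\<bar> \<le> G"
    using assms(2) unfolding bounded_iff by auto
  then show ?thesis by (rule h_semiconcave_hopf_lax)
qed

end
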